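(* Let $p(\cdot):\mathbb{Z}\to[1,\infty)$ be an exponent sequence, let $H$ be the discrete Hilbert transform, and let $1<r<p_{-}$. If $(p(\cdot)/r)'\in\mathcal{B}$, then there exists a positive constant $C$ such that \[ \|Ha\|_{\ell^{p(\cdot)}}\le C\,\|a\|_{\ell^{p(\cdot)}}\qquad\text{for all } a\in\ell^{p(\cdot)}. \]
   Context: For an exponent sequence $p(\cdot):\mathbb{Z}\to[1,\infty)$ put $p_{-}=\inf\{p(i):i\in\mathbb{Z}\}$ and $p_{+}=\sup\{p(i):i\in\mathbb{Z}\}$. The space $\ell^{p(\cdot)}=\ell^{p(\cdot)}(\mathbb{Z})$ is the set of complex sequences $a=\{a(i)\}_{i\in\mathbb{Z}}$ with \[ \|a\|_{\ell^{p(\cdot)}}=\inf\Big\{\lambda>0:\sum_{i\in\mathbb{Z}}|a(i)/\lambda|^{p(i)}\le 1\Big\}<\infty . \] The conjugate exponent $p'(\cdot)$ is defined by $\frac{1}{p(i)}+\frac{1}{p'(i)}=1$ for all $i\in\mathbb{Z}$. Here $(p(\cdot)/r)'$ denotes the conjugate exponent of the sequence $i\mapsto p(i)/r$. The discrete Hardy-Littlewood maximal operator is \[ (Ma)(j)=\sup\frac{1}{n-m+1}\sum_{i=m}^{n}|a(i)|,\qquad j\in\mathbb{Z}, \] the supremum being over all $m,n\in\mathbb{Z}$ with $m\le j\le n$. Let $\mathcal{P}$ be the set of $p(\cdot):\mathbb{Z}\to[1,\infty)$ with $1<p_{-}\le p_{+}<\infty$, and let $\mathcal{B}$ be the set of $p(\cdot)\in\mathcal{P}$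 such that $M$ is bounded on $\ell^{p(\cdot)}$ (i.e. there is a constant $K$ with $\|Ma\|_{\ell^{p(\cdot)}}\le K\|a\|_{\ell^{p(\cdot)}}$ for all $a\in\ell^{p(\cdot)}$). The discrete Hilbert transform of $a=\{a(i)\}_{i\in\mathbb{Z}}$ is \[ (Ha)(j)=\sum_{i\ne j}\frac{a(i)}{i-j},\qquad j\in\mathbb{Z}; \] it is well defined on $\ell^{p(\cdot)}$ for every $p(\cdot)\in\mathcal{P}$. *)

theory Defs
  imports "HOL-Analysis.Analysis"
begin

definition exp_inf :: "(int \<Rightarrow> real) \<Rightarrow> ereal" where
  "exp_inf p = (INF i. ereal (p i))"

definition exp_sup :: "(int \<Rightarrow> real) \<Rightarrow> ereal" where
  "exp_sup p = (SUP i. ereal (p i))"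

text \<open>At an index with \<open>p i = 1\<close>, where the conjugate exponent is infinite, this real-valued
  function takes the value \<open>0\<close>, which is not an admissible exponent.\<close>
definition conj_exp :: "(int \<Rightarrow> real) \<Rightarrow> int \<Rightarrow> real" where
  "conj_exp p i = 1 / (1 - 1 / p i)"

lemma conj_exp_iff: "1 / p i + 1 / q = 1 \<longleftrightarrow> q = conj_exp p i"
proof
  assume "1 / p i + 1 / q = 1"
  then have "1 / q = 1 - 1 / p i" by linarith
  then show "q = conj_exp p i" by (metis conj_exp_def divide_divide_eq_right mult_1 div_by_1)
qed (simp add: conj_exp_def)

text \<open>The Luxemburg norm is taken in \<open>ennreal\<close>, so that it is \<open>\<infinity>\<close> when no scaling factor \<open>l\<close> qualifies.\<close>
definition lp_norm :: "(int \<Rightarrow> real) \<Rightarrow> (int \<Rightarrow> complex) \<Rightarrow> ennreal" where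
  "lp_norm p a =
     (INF l\<in>{l::real. l > 0 \<and> (\<Sum>\<^sub>\<infinity>i\<in>UNIV. ennreal (cmod (a i / of_real l) powr p i)) \<le> 1}.
        ennreal l)"

definition lp_space :: "(int \<Rightarrow> real) \<Rightarrow> (int \<Rightarrow> complex) set" where
  "lp_space p = {a. lp_norm p a < \<infinity>}"

definition averages :: "(int \<Rightarrow> complex) \<Rightarrow> int \<Rightarrow> real set" where
  "averages a j = {(\<Sum>i=m..n. cmod (a i)) / real_of_int (n - m + 1) | m n. m \<le> j \<and> j \<le> n}"

text \<open>The supremum is real, hence meaningful only when the averages are bounded above; see
  \<open>bdd_above_averages\<close> below for sequences in the spaces considered.\<close>
definition maximal :: "(int \<Rightarrow> complex) \<Rightarrow> int \<Rightarrow> real" where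
  "maximal a j = Sup (averages a j)"

definition class_P :: "(int \<Rightarrow> real) set" where
  "class_P = {p. (\<forall>i. 1 \<le> p i) \<and> 1 < exp_inf p \<and> exp_inf p \<le> exp_sup p \<and> exp_sup p < \<infinity>}"

definition class_B :: "(int \<Rightarrow> real) set" where
  "class_B = {p \<in> class_P. \<exists>K::real. K > 0 \<and>
     (\<forall>a\<in>lp_space p. lp_norm p (\<lambda>j. of_real (maximal a j)) \<le> ennreal K * lp_norm p a)}"

text \<open>An infinite sum that does not converge unconditionally has the value \<open>0\<close>; see
  \<open>summable_hilbert\<close> below for sequences in the spaces considered.\<close>
definition hilbert :: "(int \<Rightarrow> complex) \<Rightarrow> int \<Rightarrow> complex" where
  "hilbert a j = (\<Sum>\<^sub>\<infinity>i\<in>UNIV - {j}. a i / of_int (i - j))"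

lemma lp_spaceE:
  assumes "a \<in> lp_space p"
  obtains l :: real where "l > 0"
    and "\<And>F. finite F \<Longrightarrow> (\<Sum>i\<in>F. (cmod (a i) / l) powr p i) \<le> 1"
proof -
  have "lp_norm p a \<noteq> \<infinity>" using assms by (auto simp: lp_space_def)
  then have "{l::real. l > 0 \<and> (\<Sum>\<^sub>\<infinity>i\<in>UNIV. ennreal (cmod (a i / of_real l) powr p i)) \<le> 1} \<noteq> {}"
    unfolding lp_norm_def by (metis image_empty Inf_empty infinity_ennreal_def)
  then obtain l :: real where l: "l > 0"
    "(\<Sum>\<^sub>\<infinity>i\<in>UNIV. ennreal (cmod (a i / of_real l) powr p i)) \<le> 1" by auto
  have "(\<Sum>i\<in>F. (cmod (a i) / l) powr p i) \<le> 1" if "finite F" for F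
  proof -
    have "ennreal (\<Sum>i\<in>F. (cmod (a i) / l) powr p i)
        = (\<Sum>i\<in>F. ennreal (cmod (a i / of_real l) powr p i))"
      using l(1) by (simp add: norm_divide)
    also have "\<dots> \<le> (\<Sum>\<^sub>\<infinity>i\<in>UNIV. ennreal (cmod (a i / of_real l) powr p i))"
      by (subst nonneg_infsum_complete) (use that in \<open>auto intro!: SUP_upper\<close>)
    also have "\<dots> \<le> 1" by (rule l(2))
    finally show ?thesis by simp
  qed
  then show ?thesis using that l(1) by blast
qed

lemma lp_space_bounded:
  assumes p: "\<And>i. 1 \<le> p i" and l: "l > 0"
    and *: "\<And>F. finite F \<Longrightarrow> (\<Sum>i\<in>F. (cmod (a i) / l) powr p i) \<le> 1"
  shows "cmod (a i) / l \<le> 1"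
proof (rule ccontr)
  assume "\<not> ?thesis"
  then have "1 powr p i < (cmod (a i) / l) powr p i"
    using p[of i] by (intro powr_less_mono2) auto
  with *[of "{i}"] show False by simp
qed

lemma bdd_above_averages:
  assumes "\<And>i. 1 \<le> p i" "a \<in> lp_space p"
  shows "bdd_above (averages a j)"
proof -
  obtain l where l: "l > 0" "\<And>F. finite F \<Longrightarrow> (\<Sum>i\<in>F. (cmod (a i) / l) powr p i) \<le> 1"
    using lp_spaceE[OF assms(2)] by blast
  have b: "cmod (a i) \<le> l" for i
    using lp_space_bounded[of p l a i] assms(1) l by (simp add: field_simps)
  have "(\<Sum>i=m..n. cmod (a i)) / real_of_int (n - m + 1) \<le> l" if "m \<le> j" "j \<le> n" for m n
  proof -
    have "(\<Sum>i=m..n. cmod (a i)) \<le> of_nat (card {m..n}) * l"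
      by (rule sum_bounded_above) (rule b)
    also have "\<dots> = real_of_int (n - m + 1) * l" using that by simp
    finally show ?thesis using that by (simp add: field_simps)
  qed
  then show ?thesis unfolding averages_def bdd_above_def by auto
qed

lemma summable_inverse_int_powr:
  assumes "q > 1"
  shows "(\<lambda>i::int. (1 / \<bar>real_of_int (i - j)\<bar>) powr q) summable_on UNIV - {j}"
proof -
  let ?f = "\<lambda>i::int. (1 / \<bar>real_of_int (i - j)\<bar>) powr q"
  have "summable (\<lambda>n. real n powr (- q))" using assms by (simp add: summable_real_powr_iff)
  then have s: "(\<lambda>n::nat. real n powr (- q)) summable_on UNIV"
    by (intro norm_summable_imp_summable_on) simp
  have 1: "?f summable_on range (\<lambda>n::nat. j + int n)"
    using s by (subst summable_on_reindex) (auto simp: inj_on_def o_def powr_minus powr_divide divide_simps)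
  have 2: "?f summable_on range (\<lambda>n::nat. j - int n)"
    using s by (subst summable_on_reindex) (auto simp: inj_on_def o_def powr_minus powr_divide divide_simps)
  have "?f summable_on (range (\<lambda>n::nat. j + int n) \<union> range (\<lambda>n::nat. j - int n))"
    using 1 2 by (rule summable_on_union)
  then show ?thesis
  proof (rule summable_on_subset_banach)
    show "UNIV - {j} \<subseteq> range (\<lambda>n::nat. j + int n) \<union> range (\<lambda>n::nat. j - int n)"
    proof
      fix i show "i \<in> range (\<lambda>n::nat. j + int n) \<union> range (\<lambda>n::nat. j - int n)"
      proof (cases "j \<le> i")
        case True
        then have "i = j + int (nat (i - j))" by simp
        then show ?thesis by blast
      next
        case False
        then have "i = j - int (nat (j - i))" by simp
        then show ?thesis by blast
      qed
    qed
  qed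
qed

lemma summable_hilbert:
  assumes "p \<in> class_P" "a \<in> lp_space p"
  shows "(\<lambda>i. norm (a i / of_int (i - j))) summable_on UNIV - {j}"
proof -
  have p1: "1 \<le> p i" for i using assms(1) by (auto simp: class_P_def)
  have inf: "1 < exp_inf p" and le: "exp_inf p \<le> exp_sup p" and fin: "exp_sup p < \<infinity>"
    using assms(1) by (auto simp: class_P_def)
  obtain P where P: "exp_sup p = ereal P" using fin le inf by (cases "exp_sup p") auto
  have "1 < P" using inf le P by (metis less_le_trans ereal_less(3) one_ereal_def less_ereal.simps(1))
  have pP: "p i \<le> P" for i
    using SUP_upper[of i UNIV "\<lambda>i. ereal (p i)"] P by (simp add: exp_sup_def)
  define Q where "Q = 1 / (1 - 1 / P)"
  have Q: "1 < Q" "1 / P + 1 / Q = 1" using \<open>1 < P\<close> by (auto simp: Q_def field_simps)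
  obtain l where l: "l > 0" "\<And>F. finite F \<Longrightarrow> (\<Sum>i\<in>F. (cmod (a i) / l) powr p i) \<le> 1"
    using lp_spaceE[OF assms(2)] by blast
  have b: "cmod (a i) / l \<le> 1" for i
    using lp_space_bounded[of p l a i] p1 l by blast
  have s1: "(\<lambda>i. (cmod (a i) / l) powr p i) summable_on UNIV - {j}"
    by (rule nonneg_bdd_above_summable_on) (auto simp: bdd_above_def intro!: exI[of _ 1] l(2))
  have s: "(\<lambda>i. l * ((cmod (a i) / l) powr p i + (1 / \<bar>real_of_int (i - j)\<bar>) powr Q))
      summable_on UNIV - {j}"
    by (intro summable_on_cmult_right summable_on_add s1 summable_inverse_int_powr Q(1))
  show ?thesis
  proof (rule summable_on_comparison_test[OF s])
    fix i assume "i \<in> UNIV - {j}"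
    let ?x = "cmod (a i) / l" and ?y = "1 / \<bar>real_of_int (i - j)\<bar>"
    have "?x * ?y \<le> ?x powr P / P + ?y powr Q / Q"
      using Q \<open>1 < P\<close> l(1) by (intro Youngs_inequality) auto
    also have "\<dots> \<le> ?x powr P + ?y powr Q"
      using Q(1) \<open>1 < P\<close> by (intro add_mono) (auto simp: divide_le_eq mult_le_cancel_left1)
    also have "?x powr P \<le> ?x powr p i"
      using pP b l(1) by (intro powr_mono') auto
    finally have "l * (?x * ?y) \<le> l * (?x powr p i + ?y powr Q)"
      using l(1) by (intro mult_left_mono) auto
    then show "cmod (a i / of_int (i - j)) \<le> l * (?x powr p i + ?y powr Q)"
      using l(1) by (simp add: norm_divide del: of_int_diff)
  qed auto
qed

end

theory Submission
  imports Defs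
begin

text \<open>
  The variable exponent enters only at the very end. By duality, \<open>|H a|\<^sup>r\<close> has to be tested against
  functions \<open>h \<ge> 0\<close> in the space with the exponent conjugate to \<open>p/r\<close>, where the maximal operator
  \<open>M\<close> is bounded by hypothesis. The series \<open>W = \<Sum>\<^sub>k M\<^sup>k h / (2 K)\<^sup>k\<close> of Rubio de Francia
  (\<open>Rubio_de_Francia\<close>) dominates \<open>h\<close>, has comparable norm, and satisfies \<open>M W \<le> 2 K W\<close>. It is
  thus a Muckenhoupt \<open>A\<^sub>1\<close> weight, and the theorem is reduced (\<open>extrapolation\<close>) to the classical
  inequality \<open>\<Sum> |H a|\<^sup>r W \<le> D \<Sum> |a|\<^sup>r W\<close> with \<open>D\<close> depending only on \<open>r\<close> and on the \<open>A\<^sub>1\<close> constant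
  (\<open>partial_hilbert_A1\<close>).

  The weighted inequality comes from the duality between the sharp function and the maximal
  function (\<open>sharp_duality\<close>): if \<open>F\<close> dominates the mean oscillations of \<open>f\<close> and \<open>G\<close> the averages
  of \<open>g \<ge> 0\<close> over the intervals of length \<open>2\<^sup>m\<close>, then \<open>\<Sum> |f - mean f| g \<le> 8 \<Sum> F G\<close>. This is
  applied to \<open>f = H a\<close> and \<open>g = |f|\<^bsup>r-1\<^esup> W\<close>. The oscillation of \<open>H a\<close> on an interval is controlled
  at each of its points \<open>x\<close> by \<open>(M (|a|\<^sup>q)(x))\<^bsup>1/q\<^esup>\<close> as soon as \<open>H\<close> is bounded on \<open>\<ell>\<^sup>q\<close>
  (\<open>partial_hilbert_oscillation\<close>). Because \<open>W\<close> is an \<open>A\<^sub>1\<close> weight, all averages can be replaced by averages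
  with respect to the measure with density \<open>W\<close>. For any such measure the maximal function is bounded
  on \<open>L\<^sup>t\<close>, \<open>t > 1\<close> (\<open>weighted_maximal_bound\<close>), so that Hoelder's inequality gives
  \<open>Y \<le> c X\<^bsup>1/r\<^esup> Y\<^bsup>1-1/r\<^esup>\<close> with \<open>Y = \<Sum> |H a|\<^sup>r W\<close> and \<open>X = \<Sum> |a|\<^sup>r W\<close>, and \<open>Y\<close> can be absorbed.

  This argument needs boundedness on some \<open>\<ell>\<^sup>q\<close> with \<open>q < r\<close>, which it provides itself. The case
  \<open>q = 2\<close> is an explicit computation of the kernel of \<open>H\<^sup>* H\<close> (\<open>partial_hilbert_l2\<close>); the weight
  \<open>1\<close> then gives all exponents above \<open>2\<close>, and duality those between \<open>1\<close> and \<open>2\<close> (\<open>lp_bound_all\<close>).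

  All estimates are proved for sums over a finite set of indices \<open>i\<close> with constants independent of
  the set, so that convergence is an issue only in the last step.
\<close>

section \<open>Hoelder's and Jensen's inequalities for finite sums\<close>

text \<open>Young's inequality applied termwise to \<open>u\<close> and \<open>v\<close> after normalising both to have norm \<open>1\<close>
  with respect to \<open>w\<close>; if one of the norms vanishes, so does every term on the left.\<close>

lemma Holder_sum:
  fixes u v w :: "'a \<Rightarrow> real"
  assumes A: "finite A" and pq: "p > 1" "q > 1" "1/p + 1/q = 1"
    and nn: "\<And>i. i \<in> A \<Longrightarrow> 0 \<le> u i" "\<And>i. i \<in> A \<Longrightarrow> 0 \<le> v i" "\<And>i. i \<in> A \<Longrightarrow> 0 \<le> w i"
  shows "(\<Sum>i\<in>A. u i * v i * w i)
    \<le> (\<Sum>i\<in>A. u i powr p * w i) powr (1/p) * (\<Sum>i\<in>A. v i powr q * w i) powr (1/q)"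
proof -
  define X where "X = (\<Sum>i\<in>A. u i powr p * w i)"
  define Y where "Y = (\<Sum>i\<in>A. v i powr q * w i)"
  have X0: "0 \<le> X" and Y0: "0 \<le> Y" unfolding X_def Y_def by (auto intro!: sum_nonneg mult_nonneg_nonneg simp: nn)
  show ?thesis
  proof (cases "X = 0 \<or> Y = 0")
    case True
    have "u i * v i * w i = 0" if "i \<in> A" for i
    proof -
      have "u i powr p * w i = 0 \<or> v i powr q * w i = 0"
        using True that A unfolding X_def Y_def
        by (subst (asm) (1 2) sum_nonneg_eq_0_iff) (auto simp: nn)
      then show ?thesis by auto
    qed
    then have "(\<Sum>i\<in>A. u i * v i * w i) = 0" by (intro sum.neutral ballI)
    then show ?thesis by simp
  next
    case False
    then have X: "X > 0" and Y: "Y > 0" using X0 Y0 by auto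
    define x where "x = X powr (1/p)"
    define y where "y = Y powr (1/q)"
    have xy: "x > 0" "y > 0" using X Y by (auto simp: x_def y_def)
    have xp: "x powr p = X" "y powr q = Y" using X Y pq by (auto simp: x_def y_def powr_powr)
    have "(\<Sum>i\<in>A. u i * v i * w i) / (x * y) = (\<Sum>i\<in>A. (u i / x) * (v i / y) * w i)"
      by (simp add: sum_divide_distrib)
    also have "\<dots> \<le> (\<Sum>i\<in>A. ((u i / x) powr p / p + (v i / y) powr q / q) * w i)"
      using pq xy by (intro sum_mono mult_right_mono Youngs_inequality) (auto simp: nn)
    also have "\<dots> = (\<Sum>i\<in>A. u i powr p * w i / (X * p) + v i powr q * w i / (Y * q))"
      using xy by (intro sum.cong) (auto simp: powr_divide nn xp algebra_simps)
    also have "\<dots> = X / (X * p) + Y / (Y * q)"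
      by (simp add: sum.distrib X_def Y_def sum_divide_distrib)
    also have "\<dots> = 1" using X Y pq by simp
    finally have "(\<Sum>i\<in>A. u i * v i * w i) \<le> x * y" using xy by (simp add: divide_le_eq)
    then show ?thesis by (simp add: x_def y_def X_def Y_def)
  qed
qed

text \<open>Divide by \<open>Y powr (1 - 1/r)\<close>. Each bootstrap below (strong type bounds, duality, the
  weighted inequality) ends in this way, and it works because \<open>Y\<close> is a finite sum.\<close>

lemma absorb_powr:
  fixes X Y c r :: real
  assumes "0 \<le> X" "0 \<le> Y" "0 \<le> c" "r > 1" and le: "Y \<le> c * X powr (1/r) * Y powr (1 - 1/r)"
  shows "Y \<le> c powr r * X"
proof (cases "Y = 0")
  case False
  then have Y: "Y > 0" using assms by simp
  have "Y = Y powr (1/r) * Y powr (1 - 1/r)" using Y by (simp flip: powr_add)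
  then have "Y powr (1/r) * Y powr (1 - 1/r) \<le> c * X powr (1/r) * Y powr (1 - 1/r)"
    using le by simp
  then have "Y powr (1/r) \<le> c * X powr (1/r)" using Y by simp
  then have "(Y powr (1/r)) powr r \<le> (c * X powr (1/r)) powr r"
    using assms by (intro powr_mono2) auto
  then show ?thesis using Y assms by (simp add: powr_powr powr_mult)
qed (use assms in auto)

text \<open>Hoelder's inequality against the constant \<open>1\<close>. The coefficients may add up to less than
  \<open>1\<close>, as do those of a truncated geometric series.\<close>

lemma Jensen_powr_sum:
  fixes c u :: "'a \<Rightarrow> real"
  assumes A: "finite A" and p: "p \<ge> 1" and c: "\<And>i. i \<in> A \<Longrightarrow> 0 \<le> c i" "sum c A \<le> 1"
    and u: "\<And>i. i \<in> A \<Longrightarrow> 0 \<le> u i"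
  shows "(\<Sum>i\<in>A. c i * u i) powr p \<le> (\<Sum>i\<in>A. c i * u i powr p)"
proof (cases "p = 1")
  case True
  have "0 \<le> (\<Sum>i\<in>A. c i * u i)" by (auto intro!: sum_nonneg mult_nonneg_nonneg simp: c u)
  then show ?thesis using True u by (simp add: powr_one)
next
  case False
  then have p: "p > 1" using p by simp
  define q where "q = p / (p - 1)"
  have q: "q > 1" "1/p + 1/q = 1" using p by (auto simp: q_def field_simps)
  have "(\<Sum>i\<in>A. c i * u i) = (\<Sum>i\<in>A. u i * 1 * c i)" by (simp add: mult.commute)
  also have "\<dots> \<le> (\<Sum>i\<in>A. u i powr p * c i) powr (1/p) * (\<Sum>i\<in>A. 1 powr q * c i) powr (1/q)"
    by (rule Holder_sum) (use A p q c u in auto)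
  also have "\<dots> \<le> (\<Sum>i\<in>A. u i powr p * c i) powr (1/p) * 1"
    using c q sum_nonneg[of A c] by (intro mult_left_mono) (auto intro!: powr_le1)
  finally have "(\<Sum>i\<in>A. c i * u i) \<le> (\<Sum>i\<in>A. u i powr p * c i) powr (1/p)" by simp
  then have "(\<Sum>i\<in>A. c i * u i) powr p \<le> ((\<Sum>i\<in>A. u i powr p * c i) powr (1/p)) powr p"
    using p by (intro powr_mono2 sum_nonneg mult_nonneg_nonneg) (auto simp: c u)
  also have "\<dots> = (\<Sum>i\<in>A. u i powr p * c i)"
    using p by (simp add: powr_powr powr_one sum_nonneg c)
  finally show ?thesis by (simp add: mult.commute)
qed

lemma power_mean_le:
  fixes b :: "'a \<Rightarrow> real"
  assumes X: "finite X" "X \<noteq> {}" and q: "q \<ge> 1" and b: "\<And>i. i \<in> X \<Longrightarrow> 0 \<le> b i" and z: "0 \<le> z"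
    and le: "(\<Sum>i\<in>X. b i powr q) \<le> z powr q * real (card X)"
  shows "(\<Sum>i\<in>X. b i) \<le> z * real (card X)"
proof -
  define c where "c = real (card X)"
  have c: "c > 0" using X by (simp add: c_def card_gt_0_iff)
  have "(\<Sum>i\<in>X. (1 / c) * b i) powr q \<le> (\<Sum>i\<in>X. (1 / c) * b i powr q)"
    using X q b c by (intro Jensen_powr_sum) (auto simp: c_def)
  also have "\<dots> = (\<Sum>i\<in>X. b i powr q) / c" by (simp add: sum_divide_distrib)
  also have "\<dots> \<le> z powr q" using le c by (simp add: divide_le_eq c_def)
  finally have *: "(\<Sum>i\<in>X. (1 / c) * b i) powr q \<le> z powr q" .
  have "(\<Sum>i\<in>X. (1 / c) * b i) \<le> z"
  proof (rule ccontr)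
    assume "\<not> ?thesis"
    then have "z powr q < (\<Sum>i\<in>X. (1 / c) * b i) powr q" using z q by (intro powr_less_mono2) auto
    then show False using * by simp
  qed
  then have "(\<Sum>i\<in>X. b i) / c \<le> z" by (simp add: sum_divide_distrib)
  then show ?thesis using c by (simp add: divide_le_eq c_def)
qed

lemma powr_add_le_two_powr:
  fixes a b t :: real
  assumes "0 \<le> a" "0 \<le> b" "0 \<le> t"
  shows "(a + b) powr t \<le> 2 powr t * (a powr t + b powr t)"
proof -
  have "(a + b) powr t \<le> (2 * max a b) powr t" using assms by (intro powr_mono2) auto
  also have "\<dots> = 2 powr t * max a b powr t" using assms by (simp add: powr_mult)
  also have "\<dots> \<le> 2 powr t * (a powr t + b powr t)"
    by (intro mult_left_mono) (auto simp: max_def)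
  finally show ?thesis .
qed

section \<open>The maximal function of a measure on the integers\<close>

text \<open>The layer-cake formula for the power of a single number. For \<open>t < 1\<close> the integrand is singular at \<open>0\<close>, so
  the fundamental theorem of calculus is used on the open interval.\<close>

lemma has_integral_powr_upto:
  fixes m L t :: real
  assumes t: "t > 0" and m: "0 \<le> m" "m \<le> L"
  shows "((\<lambda>s. if s < m then t * s powr (t - 1) else 0) has_integral m powr t) {0..L}"
proof -
  have "((\<lambda>s. t * s powr (t - 1)) has_integral (m powr t - 0 powr t)) {0..m}"
  proof (rule fundamental_theorem_of_calculus_interior)
    show "continuous_on {0..m} (\<lambda>s. s powr t)"
      using t by (intro continuous_on_powr') (auto intro!: continuous_intros)
    show "((\<lambda>s. s powr t) has_vector_derivative t * x powr (t - 1)) (at x)" if "x \<in> {0<..<m}" for x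
      using that by (auto intro!: derivative_eq_intros simp flip: has_real_derivative_iff_has_vector_derivative)
  qed (use m in auto)
  then have "((\<lambda>s. if s \<in> {0..m} then t * s powr (t - 1) else 0) has_integral m powr t) {0..L}"
    using m by (subst has_integral_restrict) auto
  then show ?thesis
    by (rule has_integral_spike_finite[of "{m}", rotated 2]) auto
qed

text \<open>Multiplying the weak type inequality at level \<open>s\<close> by \<open>t s\<^bsup>t-2\<^esup>\<close> and integrating over \<open>s\<close>
  gives \<open>\<Sum> M\<^sup>t W \<le> t/(t-1) \<Sum> g M\<^bsup>t-1\<^esup> W\<close>, and the power of \<open>M\<close> on the right is absorbed after
  Hoelder's inequality. This is Doob's argument: it is essential that the right-hand side of the weak
  type inequality is restricted to the set where \<open>M\<close> is large.\<close>

lemma strong_type_of_weak_type: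
  fixes M g W :: "'a \<Rightarrow> real"
  assumes E: "finite E" and t: "t > 1"
    and nn: "\<And>x. x \<in> E \<Longrightarrow> 0 \<le> M x" "\<And>x. x \<in> E \<Longrightarrow> 0 \<le> g x" "\<And>x. x \<in> E \<Longrightarrow> 0 \<le> W x"
    and weak_type: "\<And>s. s > 0 \<Longrightarrow> s * (\<Sum>x | x \<in> E \<and> s < M x. W x) \<le> (\<Sum>x | x \<in> E \<and> s < M x. g x * W x)"
  shows "(\<Sum>x\<in>E. M x powr t * W x) \<le> (t / (t - 1)) powr t * (\<Sum>x\<in>E. g x powr t * W x)"
proof -
  define L where "L = (\<Sum>x\<in>E. M x)"
  have M_le: "M x \<le> L" if "x \<in> E" for x
    unfolding L_def using that E by (intro member_le_sum) (auto simp: nn)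
  define l where "l s = (\<Sum>x\<in>E. W x * (if s < M x then t * s powr (t - 1) else 0))" for s
  define r where "r s = (\<Sum>x\<in>E. (t / (t - 1) * (g x * W x)) *
      (if s < M x then (t - 1) * s powr (t - 1 - 1) else 0))" for s
  have I1: "(l has_integral (\<Sum>x\<in>E. W x * M x powr t)) {0..L}"
    unfolding l_def using t
    by (intro has_integral_sum E has_integral_mult_right has_integral_powr_upto) (auto simp: nn M_le)
  have I2: "(r has_integral (\<Sum>x\<in>E. (t / (t - 1) * (g x * W x)) * M x powr (t - 1))) {0..L}"
    unfolding r_def using t
    by (intro has_integral_sum E has_integral_mult_right has_integral_powr_upto) (auto simp: nn M_le)
  have le: "l s \<le> r s" if "s \<in> {0..L}" for s
  proof (cases "s = 0")
    case False
    then have s: "s > 0" using that by simp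
    have "l s = t * s powr (t - 2) * (s * (\<Sum>x | x \<in> E \<and> s < M x. W x))"
    proof -
      have "s powr (t - 1) = s powr (t - 2) * s"
        using s powr_add[of s "t - 2" 1] by (simp add: powr_one)
      then show ?thesis
        unfolding l_def using E
        by (simp add: sum.inter_filter sum_distrib_left if_distrib cong: if_cong)
           (auto intro!: sum.cong)
    qed
    also have "\<dots> \<le> t * s powr (t - 2) * (\<Sum>x | x \<in> E \<and> s < M x. g x * W x)"
      using t by (intro mult_left_mono weak_type s) auto
    also have "\<dots> = r s"
      unfolding r_def using E t
      by (simp add: sum.inter_filter sum_distrib_left if_distrib cong: if_cong)
         (auto intro!: sum.cong)
    finally show ?thesis .
  qed (use t in \<open>simp add: l_def r_def if_distrib cong: if_cong\<close>)
  define q where "q = t / (t - 1)"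
  have q: "q > 1" "1/t + 1/q = 1" "(t - 1) * q = t" "1/q = 1 - 1/t" using t by (auto simp: q_def field_simps)
  define X where "X = (\<Sum>x\<in>E. g x powr t * W x)"
  define Y where "Y = (\<Sum>x\<in>E. M x powr t * W x)"
  have "Y \<le> (\<Sum>x\<in>E. (t / (t - 1) * (g x * W x)) * M x powr (t - 1))"
    using has_integral_le[OF I1 I2 le] by (simp add: Y_def mult.commute)
  also have "\<dots> = q * (\<Sum>x\<in>E. g x * M x powr (t - 1) * W x)"
    by (simp add: q_def sum_distrib_left mult_ac)
  also have "\<dots> \<le> q * ((\<Sum>x\<in>E. g x powr t * W x) powr (1/t) *
      (\<Sum>x\<in>E. (M x powr (t - 1)) powr q * W x) powr (1/q))"
    using q t by (intro mult_left_mono Holder_sum E) (auto simp: nn)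
  also have "\<dots> = q * X powr (1/t) * Y powr (1 - 1/t)"
    by (simp add: powr_powr q(3,4) X_def Y_def)
  finally have "Y \<le> q powr t * X"
    by (intro absorb_powr) (use t q in \<open>auto simp: X_def Y_def nn intro!: sum_nonneg mult_nonneg_nonneg\<close>)
  then show ?thesis by (simp add: X_def Y_def q_def)
qed

text \<open>The maximum of the sums of \<open>c j, \<dots>, c (k - 1)\<close> over \<open>j \<le> k\<close>, the empty sum included.\<close>

primrec max_tail_sum :: "(nat \<Rightarrow> real) \<Rightarrow> nat \<Rightarrow> real" where
  "max_tail_sum c 0 = 0"
| "max_tail_sum c (Suc k) = max 0 (c k + max_tail_sum c k)"

lemma max_tail_sum_nonneg: "0 \<le> max_tail_sum c k"
  by (cases k) auto

lemma max_tail_sum_ge: "j \<le> k \<Longrightarrow> (\<Sum>i=j..k. c i) \<le> max_tail_sum c (Suc k)"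
proof (induction k)
  case (Suc k)
  show ?case
  proof (cases "j = Suc k")
    case True then show ?thesis using max_tail_sum_nonneg[of c "Suc k"] by simp
  next
    case False
    then have "(\<Sum>i=j..k. c i) \<le> max_tail_sum c (Suc k)" using Suc by simp
    then show ?thesis using Suc.prems False by (simp add: max_def)
  qed
qed simp

lemma max_tail_sum_attained:
  "0 < max_tail_sum c (Suc k) \<Longrightarrow> \<exists>j\<le>k. max_tail_sum c (Suc k) = (\<Sum>i=j..k. c i)"
proof (induction k)
  case (Suc k)
  show ?case
  proof (cases "0 < max_tail_sum c (Suc k)")
    case True
    then obtain j where "j \<le> k" "max_tail_sum c (Suc k) = (\<Sum>i=j..k. c i)" using Suc.IH by blast
    then show ?thesis using Suc.prems by (intro exI[of _ j]) (auto simp: max_def split: if_splits)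
  next
    case False
    then have "max_tail_sum c (Suc k) = 0" using max_tail_sum_nonneg[of c "Suc k"] by linarith
    then show ?thesis using Suc.prems
      by (intro exI[of _ "Suc k"]) (auto simp: max_def split: if_splits)
  qed
qed (auto simp: max_def split: if_splits)

text \<open>Hopf's maximal inequality. Where \<open>max_tail_sum\<close> is positive after step \<open>k\<close> it has changed by exactly
  \<open>c k\<close>, and where it is zero it has not increased; summing the increments gives the claim.\<close>

lemma Hopf_maximal: "max_tail_sum c n \<le> (\<Sum>k | k < n \<and> 0 < max_tail_sum c (Suc k). c k)"
proof (induction n)
  case (Suc n)
  have "{k. k < Suc n \<and> 0 < max_tail_sum c (Suc k)} =
     (if 0 < max_tail_sum c (Suc n) then insert n {k. k < n \<and> 0 < max_tail_sum c (Suc k)}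
      else {k. k < n \<and> 0 < max_tail_sum c (Suc k)})"
    by (auto simp: less_Suc_eq simp del: max_tail_sum.simps)
  moreover have "max_tail_sum c (Suc n) = (if 0 < max_tail_sum c (Suc n) then c n + max_tail_sum c n else 0)"
    by auto
  moreover have "0 \<le> max_tail_sum c n" by (rule max_tail_sum_nonneg)
  ultimately show ?case using Suc by (auto simp del: max_tail_sum.simps split: if_splits)
qed simp

definition left_maximal :: "(int \<Rightarrow> real) \<Rightarrow> (int \<Rightarrow> real) \<Rightarrow> int \<Rightarrow> real" where
  "left_maximal W g x = (SUP n::nat. (\<Sum>i=x - int n..x. g i * W i) / (\<Sum>i=x - int n..x. W i))"

lemma bdd_above_left_averages:
  assumes W: "\<And>i. 0 < W i" and g: "\<And>i. g i \<le> (B::real)"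
  shows "bdd_above (range (\<lambda>n::nat. (\<Sum>i=x - int n..x. g i * W i) / (\<Sum>i=x - int n..x. W i)))"
proof (rule bdd_aboveI2)
  fix n :: nat
  have "0 < (\<Sum>i=x - int n..x. W i)" by (intro sum_pos) (auto simp: W)
  moreover have "(\<Sum>i=x - int n..x. g i * W i) \<le> B * (\<Sum>i=x - int n..x. W i)"
    unfolding sum_distrib_left by (intro sum_mono mult_right_mono) (auto simp: g W less_imp_le)
  ultimately show "(\<Sum>i=x - int n..x. g i * W i) / (\<Sum>i=x - int n..x. W i) \<le> B"
    by (simp add: divide_le_eq)
qed

lemma left_average_le:
  assumes W: "\<And>i. 0 < W i" and g: "\<And>i. g i \<le> (B::real)" and m: "m \<le> x"
  shows "(\<Sum>i=m..x. g i * W i) \<le> left_maximal W g x * (\<Sum>i=m..x. W i)"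
proof -
  have "0 < (\<Sum>i=m..x. W i)" using m by (intro sum_pos) (auto simp: W)
  moreover have "(\<Sum>i=m..x. g i * W i) / (\<Sum>i=m..x. W i) \<le> left_maximal W g x"
    using cSUP_upper[OF UNIV_I bdd_above_left_averages[of W g B x, OF W g], of "nat (x - m)"] m
    by (simp add: left_maximal_def)
  ultimately show ?thesis by (simp add: divide_le_eq)
qed

lemma left_maximal_nonneg:
  assumes W: "\<And>i. 0 < W i" and g: "\<And>i. 0 \<le> g i" "\<And>i. g i \<le> (B::real)"
  shows "0 \<le> left_maximal W g x"
proof -
  have "0 \<le> g x * W x" using W[of x] g(1)[of x] by simp
  also have "\<dots> \<le> left_maximal W g x * W x" using left_average_le[OF W g(2), of x x] by simp
  finally show ?thesis using W[of x] by (simp add: zero_le_mult_iff)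
qed

text \<open>Apply Hopf's inequality to \<open>(g - s) W\<close> on a window that contains \<open>E\<close> and, for every
  point where the maximal function exceeds \<open>s\<close>, an interval that shows it. Inside \<open>E\<close>, the points with
  a positive maximal sum ending there are exactly those where the maximal function exceeds \<open>s\<close>;
  outside \<open>E\<close> the summand is negative and can be dropped.\<close>

lemma left_maximal_weak_type:
  assumes W: "\<And>i. 0 < W i" and g: "\<And>i. 0 \<le> g i" "\<And>i. g i \<le> (B::real)"
    and E: "finite E" "\<And>i. i \<notin> E \<Longrightarrow> g i = 0" and s: "s > 0"
  shows "s * (\<Sum>x | x \<in> E \<and> s < left_maximal W g x. W x)
    \<le> (\<Sum>x | x \<in> E \<and> s < left_maximal W g x. g x * W x)"
proof -
  define D where "D = {x\<in>E. s < left_maximal W g x}"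
  have finD: "finite D" using E by (simp add: D_def)
  have "\<exists>n::nat. s * (\<Sum>i=x - int n..x. W i) < (\<Sum>i=x - int n..x. g i * W i)" if "x \<in> D" for x
  proof -
    from that obtain n :: nat where
      n: "s < (\<Sum>i=x - int n..x. g i * W i) / (\<Sum>i=x - int n..x. W i)"
      using less_cSUP_iff[OF _ bdd_above_left_averages[of W g B, OF W g(2)], of s x]
      by (auto simp: D_def left_maximal_def)
    moreover have "0 < (\<Sum>i=x - int n..x. W i)" by (intro sum_pos) (auto simp: W)
    ultimately show ?thesis by (auto simp: less_divide_eq)
  qed
  then obtain nx where nx: "\<And>x. x \<in> D \<Longrightarrow> s * (\<Sum>i=x - int (nx x)..x. W i) < (\<Sum>i=x - int (nx x)..x. g i * W i)"
    by metis
  have "\<exists>L. \<forall>y \<in> E \<union> (\<lambda>x. x - int (nx x)) ` D. L \<le> y"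
    using E finD by (intro bdd_below.unfold[THEN iffD1] bdd_below_finite) auto
  then obtain L where L: "\<And>y. y \<in> E \<Longrightarrow> L \<le> y" "\<And>x. x \<in> D \<Longrightarrow> L \<le> x - int (nx x)" by auto
  have "\<exists>U. \<forall>y \<in> E. y \<le> U"
    using E by (intro bdd_above.unfold[THEN iffD1] bdd_above_finite) auto
  then obtain U where U: "\<And>y. y \<in> E \<Longrightarrow> y \<le> U" by auto
  define N where "N = nat (U - L + 1)"
  define c where "c k = (g (L + int k) - s) * W (L + int k)" for k :: nat
  have csum: "(\<Sum>i=j..k. c i) = (\<Sum>i=L + int j..L + int k. g i * W i) - s * (\<Sum>i=L + int j..L + int k. W i)" for j k
  proof -
    have "(\<Sum>i=j..k. c i) = (\<Sum>i=L + int j..L + int k. (g i - s) * W i)"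
      unfolding c_def
      by (rule sum.reindex_bij_witness[of _ "\<lambda>i. nat (i - L)" "\<lambda>i. L + int i"]) auto
    then show ?thesis by (simp add: algebra_simps sum_subtractf sum_distrib_left)
  qed
  define D1 where "D1 = {k. k < N \<and> 0 < max_tail_sum c (Suc k)}"
  have fin1: "finite D1" by (simp add: D1_def)
  \<comment> \<open>Inside \<open>E\<close> both conditions say that some interval ending at \<open>L + k\<close> has average above \<open>s\<close>;
    the choice of \<open>L\<close> keeps such an interval inside the window.\<close>
  have mem: "k \<in> D1 \<longleftrightarrow> L + int k \<in> D" if "L + int k \<in> E" for k
  proof
    assume "k \<in> D1"
    then have pos: "0 < max_tail_sum c (Suc k)" by (simp add: D1_def del: max_tail_sum.simps)
    from max_tail_sum_attained[OF this] pos obtain j where j: "j \<le> k" "0 < (\<Sum>i=j..k. c i)"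
      by (auto simp del: max_tail_sum.simps)
    have pos': "0 < (\<Sum>i=L + int j..L + int k. W i)" using j by (intro sum_pos) (auto simp: W)
    have "s * (\<Sum>i=L + int j..L + int k. W i) < (\<Sum>i=L + int j..L + int k. g i * W i)"
      using j(2) csum by simp
    also have "\<dots> \<le> left_maximal W g (L + int k) * (\<Sum>i=L + int j..L + int k. W i)"
      using j by (intro left_average_le[OF W g(2)]) auto
    finally have "s < left_maximal W g (L + int k)" using pos' by simp
    then show "L + int k \<in> D" using that by (simp add: D_def)
  next
    assume D: "L + int k \<in> D"
    define j where "j = nat (L + int k - int (nx (L + int k)) - L)"
    have j: "L + int j = L + int k - int (nx (L + int k))" "j \<le> k"
      using L(2)[OF D] by (auto simp: j_def)
    have "0 < (\<Sum>i=j..k. c i)" unfolding csum j(1) using nx[OF D] by simp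
    also have "\<dots> \<le> max_tail_sum c (Suc k)" using j(2) by (rule max_tail_sum_ge)
    finally show "k \<in> D1" using U[OF that] by (auto simp: D1_def N_def simp del: max_tail_sum.simps)
  qed
  have "0 \<le> max_tail_sum c N" by (rule max_tail_sum_nonneg)
  also have "\<dots> \<le> sum c D1" unfolding D1_def by (rule Hopf_maximal)
  also have "\<dots> \<le> sum c {k\<in>D1. L + int k \<in> E}"
  proof -
    have "sum c (D1 - {k\<in>D1. L + int k \<in> E}) \<le> 0"
      by (intro sum_nonpos) (use W s E(2) in \<open>auto simp: c_def mult_le_0_iff less_imp_le\<close>)
    then show ?thesis
      using sum.subset_diff[of "{k\<in>D1. L + int k \<in> E}" D1 c] fin1 by auto
  qed
  also have "\<dots> = (\<Sum>x\<in>D. (g x - s) * W x)"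
    unfolding c_def
  proof (rule sum.reindex_bij_witness[of _ "\<lambda>i. nat (i - L)" "\<lambda>i. L + int i"])
    fix x assume x: "x \<in> D"
    then have "x \<in> E" by (simp add: D_def)
    then have "L + int (nat (x - L)) = x" using L(1) by simp
    then show "L + int (nat (x - L)) = x" "nat (x - L) \<in> {k\<in>D1. L + int k \<in> E}"
      using x \<open>x \<in> E\<close> mem[of "nat (x - L)"] by auto
  qed (use mem in auto)
  also have "\<dots> = (\<Sum>x\<in>D. g x * W x) - s * (\<Sum>x\<in>D. W x)"
    by (simp add: algebra_simps sum_subtractf sum_distrib_left)
  finally show ?thesis by (simp add: D_def)
qed

lemma left_maximal_strong_type:
  assumes W: "\<And>i. 0 < W i" and g: "\<And>i. 0 \<le> g i" and A: "finite A" "\<And>i. i \<notin> A \<Longrightarrow> g i = 0"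
    and t: "t > 1" and E: "finite E"
  shows "(\<Sum>x\<in>E. left_maximal W g x powr t * W x) \<le> (t / (t - 1)) powr t * (\<Sum>x\<in>A. g x powr t * W x)"
proof -
  have gB: "g i \<le> sum g A" for i
    using A g by (cases "i \<in> A") (auto intro!: member_le_sum sum_nonneg)
  have "(\<Sum>x\<in>E. left_maximal W g x powr t * W x) \<le> (\<Sum>x\<in>E \<union> A. left_maximal W g x powr t * W x)"
    using A E W by (intro sum_mono2) (auto simp: less_imp_le)
  also have "\<dots> \<le> (t / (t - 1)) powr t * (\<Sum>x\<in>E \<union> A. g x powr t * W x)"
    using A E W g t gB
    by (intro strong_type_of_weak_type left_maximal_weak_type[where B = "sum g A"]
        left_maximal_nonneg[where B = "sum g A"]) (auto simp: less_imp_le)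
  also have "(\<Sum>x\<in>E \<union> A. g x powr t * W x) = (\<Sum>x\<in>A. g x powr t * W x)"
    using A E t by (intro sum.mono_neutral_right) auto
  finally show ?thesis .
qed

text \<open>An interval around \<open>x\<close> splits at \<open>x\<close> into a left and a right part, so the uncentred
  maximal function is at most the sum of the two one-sided ones, and the right one is the reflection of
  the left one.\<close>

lemma weighted_maximal_bound:
  fixes W g :: "int \<Rightarrow> real"
  assumes W: "\<And>i. 0 < W i" and g: "\<And>i. 0 \<le> g i" and A: "finite A" "\<And>i. i \<notin> A \<Longrightarrow> g i = 0"
    and t: "t > 1"
  obtains G where "\<And>x. 0 \<le> G x"
    and "\<And>m n x. m \<le> x \<Longrightarrow> x \<le> n \<Longrightarrow> (\<Sum>i=m..n. g i * W i) \<le> G x * (\<Sum>i=m..n. W i)"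
    and "\<And>E. finite E \<Longrightarrow> (\<Sum>x\<in>E. G x powr t * W x)
           \<le> (2 powr t * 2 * (t / (t - 1)) powr t) * (\<Sum>x\<in>A. g x powr t * W x)"
proof -
  have gB: "g i \<le> sum g A" for i
    using A g by (cases "i \<in> A") (auto intro!: member_le_sum sum_nonneg)
  define W' where "W' i = W (- i)" for i
  define g' where "g' i = g (- i)" for i
  define l where "l = left_maximal W g"
  define r where "r x = left_maximal W' g' (- x)" for x
  have W': "0 < W' i" and g': "0 \<le> g' i" and gB': "g' i \<le> sum g A" for i
    using W g gB by (auto simp: W'_def g'_def)
  have nn: "0 \<le> l x" "0 \<le> r x" for x
    unfolding l_def r_def
    by (rule left_maximal_nonneg[OF W g gB], rule left_maximal_nonneg[OF W' g' gB'])
  have flip: "(\<Sum>i=x..n. h (- i)) = (\<Sum>i= - n.. - x. h i)" for h :: "int \<Rightarrow> real" and x n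
    by (rule sum.reindex_bij_witness[of _ uminus uminus]) auto
  have right: "(\<Sum>i=x..n. g i * W i) \<le> r x * (\<Sum>i=x..n. W i)" if "x \<le> n" for x n
  proof -
    have "(\<Sum>i= - n.. - x. g' i * W' i) = (\<Sum>i=x..n. g i * W i)"
      by (subst flip[symmetric]) (simp add: g'_def W'_def)
    moreover have "(\<Sum>i= - n.. - x. W' i) = (\<Sum>i=x..n. W i)"
      by (subst flip[symmetric]) (simp add: W'_def)
    ultimately show ?thesis
      using left_average_le[of W' g' "sum g A" "- n" "- x", OF W' gB'] that by (simp add: r_def)
  qed
  show ?thesis
  proof (rule that[of "\<lambda>x. l x + r x"])
    show "0 \<le> l x + r x" for x using nn[of x] by simp
    show "(\<Sum>i=m..n. g i * W i) \<le> (l x + r x) * (\<Sum>i=m..n. W i)" if "m \<le> x" "x \<le> n" for m n x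
    proof -
      have "(\<Sum>i=m..n. g i * W i) \<le> (\<Sum>i\<in>{m..x} \<union> {x..n}. g i * W i)"
        using that W g by (intro sum_mono2) (auto simp: less_imp_le)
      also have "\<dots> \<le> (\<Sum>i=m..x. g i * W i) + (\<Sum>i=x..n. g i * W i)"
        using W g by (subst sum.union_inter[symmetric]) (auto intro!: sum_nonneg simp: less_imp_le)
      also have "\<dots> \<le> l x * (\<Sum>i=m..x. W i) + r x * (\<Sum>i=x..n. W i)"
        using left_average_le[of W g "sum g A" m x, OF W gB that(1)] right[OF that(2)]
        by (simp add: l_def)
      also have "\<dots> \<le> l x * (\<Sum>i=m..n. W i) + r x * (\<Sum>i=m..n. W i)"
        using that W by (intro add_mono mult_left_mono sum_mono2 nn) (auto simp: less_imp_le)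
      finally show ?thesis by (simp add: algebra_simps)
    qed
    fix E :: "int set" assume E: "finite E"
    have "(\<Sum>x\<in>E. r x powr t * W x) = (\<Sum>x\<in>uminus ` E. left_maximal W' g' x powr t * W' x)"
      by (subst sum.reindex) (auto simp: r_def W'_def)
    also have "\<dots> \<le> (t / (t - 1)) powr t * (\<Sum>x\<in>uminus ` A. g' x powr t * W' x)"
      using A E t W' g' by (intro left_maximal_strong_type) (auto simp: g'_def image_iff, metis minus_minus)
    also have "(\<Sum>x\<in>uminus ` A. g' x powr t * W' x) = (\<Sum>x\<in>A. g x powr t * W x)"
      by (subst sum.reindex) (auto simp: g'_def W'_def)
    finally have r: "(\<Sum>x\<in>E. r x powr t * W x) \<le> (t / (t - 1)) powr t * (\<Sum>x\<in>A. g x powr t * W x)" .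
    have "(\<Sum>x\<in>E. (l x + r x) powr t * W x) \<le> (\<Sum>x\<in>E. 2 powr t * (l x powr t + r x powr t) * W x)"
      using t nn W by (intro sum_mono mult_right_mono powr_add_le_two_powr) (auto simp: less_imp_le)
    also have "\<dots> = 2 powr t * ((\<Sum>x\<in>E. l x powr t * W x) + (\<Sum>x\<in>E. r x powr t * W x))"
      by (simp add: algebra_simps sum.distrib sum_distrib_left)
    also have "\<dots> \<le> 2 powr t * ((t / (t - 1)) powr t * (\<Sum>x\<in>A. g x powr t * W x)
        + (t / (t - 1)) powr t * (\<Sum>x\<in>A. g x powr t * W x))"
      using left_maximal_strong_type[of W g A t E, OF W g A t E] r by (intro mult_left_mono add_mono) (auto simp: l_def)
    finally show "(\<Sum>x\<in>E. (l x + r x) powr t * W x)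
           \<le> (2 powr t * 2 * (t / (t - 1)) powr t) * (\<Sum>x\<in>A. g x powr t * W x)"
      by (simp add: algebra_simps)
  qed
qed

section \<open>Duality between oscillations and averages\<close>

definition pow2_interval :: "int \<Rightarrow> nat \<Rightarrow> int set" where
  "pow2_interval l n = {l..<l + 2 ^ n}"

lemma finite_pow2_interval [simp]: "finite (pow2_interval l n)"
  by (simp add: pow2_interval_def)

lemma card_pow2_interval: "real (card (pow2_interval l n)) = 2 ^ n"
  by (simp add: pow2_interval_def)

lemma pow2_interval_0 [simp]: "pow2_interval l 0 = {l}"
  by (auto simp: pow2_interval_def)

lemma pow2_interval_Suc: "pow2_interval l (Suc n) = pow2_interval l n \<union> pow2_interval (l + 2 ^ n) n" "pow2_interval l n \<inter> pow2_interval (l + 2 ^ n) n = {}"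
  by (auto simp: pow2_interval_def)

text \<open>The Calderon-Zygmund decomposition at height \<open>s\<close>. Halving an interval whose average is at
  most \<open>s\<close> at most doubles the average, so each half is either selected or can be decomposed further; a
  single point that is never selected has value at most \<open>s\<close>.\<close>

lemma stopping_intervals:
  fixes g :: "int \<Rightarrow> real"
  assumes g: "\<And>i. 0 \<le> g i" and avg: "sum g (pow2_interval l n) \<le> s * 2 ^ n"
  shows "\<exists>P. finite P \<and> disjoint P \<and> (\<forall>i\<in>pow2_interval l n - \<Union>P. g i \<le> s) \<and>
     (\<forall>X\<in>P. X \<subseteq> pow2_interval l n) \<and> (\<forall>X\<in>P. (\<exists>k m. m < n \<and> X = pow2_interval k m \<and> s * 2 ^ m < sum g X \<and> sum g X \<le> 2 * s * 2 ^ m))"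
  using avg
proof (induction n arbitrary: l)
  case 0
  then show ?case by (intro exI[of _ "{}"]) auto
next
  case (Suc n)
  have half: "\<exists>P. finite P \<and> disjoint P \<and> (\<forall>i\<in>pow2_interval k n - \<Union>P. g i \<le> s) \<and>
     (\<forall>X\<in>P. X \<subseteq> pow2_interval k n) \<and> (\<forall>X\<in>P. (\<exists>k m. m < Suc n \<and> X = pow2_interval k m \<and> s * 2 ^ m < sum g X \<and> sum g X \<le> 2 * s * 2 ^ m))"
    if k: "pow2_interval k n \<subseteq> pow2_interval l (Suc n)" for k
  proof (cases "sum g (pow2_interval k n) \<le> s * 2 ^ n")
    case True
    from Suc.IH[OF True] show ?thesis by (meson less_SucI)
  next
    case False
    have "sum g (pow2_interval k n) \<le> sum g (pow2_interval l (Suc n))" using k g by (intro sum_mono2) auto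
    also have "\<dots> \<le> 2 * s * 2 ^ n" using Suc.prems by simp
    finally show ?thesis using False
      by (intro exI[of _ "{pow2_interval k n}"]) (auto intro!: exI[of _ k] exI[of _ n])
  qed
  obtain P where P: "finite P" "disjoint P" "\<forall>i\<in>pow2_interval l n - \<Union>P. g i \<le> s" "\<forall>X\<in>P. X \<subseteq> pow2_interval l n"
     "\<forall>X\<in>P. \<exists>k m. m < Suc n \<and> X = pow2_interval k m \<and> s * 2 ^ m < sum g X \<and> sum g X \<le> 2 * s * 2 ^ m"
    using half[of l] pow2_interval_Suc by auto
  obtain Q where Q: "finite Q" "disjoint Q" "\<forall>i\<in>pow2_interval (l + 2 ^ n) n - \<Union>Q. g i \<le> s"
     "\<forall>X\<in>Q. X \<subseteq> pow2_interval (l + 2 ^ n) n"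
     "\<forall>X\<in>Q. \<exists>k m. m < Suc n \<and> X = pow2_interval k m \<and> s * 2 ^ m < sum g X \<and> sum g X \<le> 2 * s * 2 ^ m"
    using half[of "l + 2 ^ n"] pow2_interval_Suc by auto
  have sub: "\<Union>P \<subseteq> pow2_interval l n" "\<Union>Q \<subseteq> pow2_interval (l + 2 ^ n) n" using P(4) Q(4) by blast+
  have "\<Union>P \<inter> \<Union>Q = {}" using sub pow2_interval_Suc(2)[of l n] by blast
  then have "disjoint (P \<union> Q)" by (rule disjoint_union[OF P(2) Q(2)])
  moreover have "\<forall>i\<in>pow2_interval l (Suc n) - \<Union>(P \<union> Q). g i \<le> s"
    using P(3) Q(3) by (auto simp: pow2_interval_Suc(1))
  moreover have "\<forall>X\<in>P \<union> Q. X \<subseteq> pow2_interval l (Suc n)"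
    using sub unfolding pow2_interval_Suc(1) by blast
  moreover have "\<forall>X\<in>P \<union> Q. \<exists>k m. m < Suc n \<and> X = pow2_interval k m \<and> s * 2 ^ m < sum g X \<and> sum g X \<le> 2 * s * 2 ^ m"
    using P(5) Q(5) by (intro ballI) (elim UnE; simp)
  ultimately show ?case using P(1) Q(1) by (intro exI[of _ "P \<union> Q"] conjI finite_UnI)
qed

definition mean :: "int set \<Rightarrow> (int \<Rightarrow> complex) \<Rightarrow> complex" where
  "mean X f = sum f X / of_nat (card X)"

text \<open>Among all constants the mean is optimal for the mean absolute deviation up to a factor of \<open>2\<close>.\<close>

lemma sum_deviation_mean_le:
  assumes "finite X" "X \<noteq> {}"
  shows "(\<Sum>i\<in>X. cmod (f i - mean X f)) \<le> 2 * (\<Sum>i\<in>X. cmod (f i - c))"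
proof -
  have cX: "real (card X) > 0" using assms by (simp add: card_gt_0_iff)
  have "of_nat (card X) * (c - mean X f) = - (\<Sum>i\<in>X. f i - c)"
    using cX by (auto simp: sum_subtractf mean_def algebra_simps)
  then have "real (card X) * cmod (c - mean X f) = cmod (\<Sum>i\<in>X. f i - c)"
    by (metis norm_minus_cancel norm_mult norm_of_nat)
  also have "\<dots> \<le> (\<Sum>i\<in>X. cmod (f i - c))" by (rule norm_sum)
  finally have jump: "real (card X) * cmod (c - mean X f) \<le> (\<Sum>i\<in>X. cmod (f i - c))" .
  have "(\<Sum>i\<in>X. cmod (f i - mean X f)) \<le> (\<Sum>i\<in>X. cmod (f i - c) + cmod (c - mean X f))"
  proof (rule sum_mono)
    show "cmod (f i - mean X f) \<le> cmod (f i - c) + cmod (c - mean X f)" for i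
      using norm_triangle_ineq[of "f i - c" "c - mean X f"] by simp
  qed
  then show ?thesis using jump by (simp add: sum.distrib)
qed

text \<open>A form of the duality between BMO and the Hardy space. Select the maximal subintervals
  where the average of \<open>g\<close> exceeds twice its average on the whole interval \<open>S\<close>. Off them \<open>g\<close> is bounded by a
  multiple of its average; on them, replacing the mean of \<open>f\<close> over \<open>S\<close> by the means over
  the subintervals costs at most the same multiple of the sum of \<open>|f - mean S f|\<close>, and what
  remains is covered by induction. The selected intervals fill at most half of \<open>S\<close>, so the
  product of oscillation and average over \<open>S\<close> can be charged to the part of \<open>S\<close> outside them,
  and every point is charged once.\<close>

lemma sharp_duality:
  fixes f :: "int \<Rightarrow> complex" and g F G :: "int \<Rightarrow> real"
  assumes g: "\<And>i. 0 \<le> g i" and F: "\<And>i. 0 \<le> F i" and G: "\<And>i. 0 \<le> G i"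
    and osc: "\<And>k m x. x \<in> pow2_interval k m \<Longrightarrow> (\<Sum>i\<in>pow2_interval k m. cmod (f i - mean (pow2_interval k m) f)) \<le> F x * 2 ^ m"
    and avg: "\<And>k m x. x \<in> pow2_interval k m \<Longrightarrow> sum g (pow2_interval k m) \<le> G x * 2 ^ m"
  shows "(\<Sum>i\<in>pow2_interval l n. cmod (f i - mean (pow2_interval l n) f) * g i) \<le> 8 * (\<Sum>i\<in>pow2_interval l n. F i * G i)"
proof (induction n arbitrary: l rule: less_induct)
  case (less n)
  define S where "S = pow2_interval l n"
  \<comment> \<open>Twice the average of \<open>g\<close>, so that the selected intervals fill at most half of \<open>S\<close>.\<close>
  define s where "s = 2 * sum g S / 2 ^ n"
  have finS: "finite S" by (simp add: S_def)
  show ?case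
  proof (cases "sum g S = 0")
    case True
    then have "g i = 0" if "i \<in> S" for i using that g finS by (simp add: sum_nonneg_eq_0_iff)
    then have "(\<Sum>i\<in>S. cmod (f i - mean S f) * g i) = 0" by (intro sum.neutral) auto
    then show ?thesis using F G by (simp add: S_def sum_nonneg)
  next
    case False
    then have pos: "sum g S > 0" using g by (simp add: less_le sum_nonneg)
    then have s: "s > 0" by (simp add: s_def)
    have "sum g S \<le> s * 2 ^ n" using pos by (simp add: s_def)
    from stopping_intervals[OF g this[unfolded S_def], folded S_def] obtain P where
      P: "finite P" "disjoint P" "\<forall>i\<in>S - \<Union>P. g i \<le> s"
        "\<forall>X\<in>P. X \<subseteq> S"
        "\<forall>X\<in>P. \<exists>k m. m < n \<and> X = pow2_interval k m \<and> s * 2 ^ m < sum g X \<and> sum g X \<le> 2 * s * 2 ^ m"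
      by (elim exE conjE) (rule that)
    have PX: "\<exists>k m. m < n \<and> X = pow2_interval k m \<and> s * 2 ^ m < sum g X \<and> sum g X \<le> 2 * s * 2 ^ m" if "X \<in> P" for X
      using P(5) that by (rule bspec)
    have PS: "X \<subseteq> S" if "X \<in> P" for X using P(4) that by simp
    define U where "U = \<Union>P"
    have US: "U \<subseteq> S" using PS by (auto simp: U_def)
    have finU: "finite U" by (rule finite_subset[OF US finS])
    have finX: "finite X" if "X \<in> P" for X by (rule finite_subset[OF PS[OF that] finS])
    have sumU: "sum h U = (\<Sum>X\<in>P. sum h X)" for h :: "int \<Rightarrow> real"
    proof -
      have "\<forall>X\<in>P. \<forall>Y\<in>P. X \<noteq> Y \<longrightarrow> X \<inter> Y = {}" using P(2) by (auto simp: disjoint_def)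
      then show ?thesis unfolding U_def using finX by (subst sum.Union_disjoint) auto
    qed
    have small: "s * real (card U) \<le> s * (real (card S) / 2)"
    proof -
      have "s * real (card U) = (\<Sum>X\<in>P. s * real (card X))"
        using sumU[of "\<lambda>_. s"] by (simp add: mult.commute)
      also have "\<dots> \<le> (\<Sum>X\<in>P. sum g X)"
      proof (rule sum_mono)
        fix X assume "X \<in> P"
        then obtain k m where X: "X = pow2_interval k m" "s * 2 ^ m < sum g X" using PX by blast
        then show "s * real (card X) \<le> sum g X" by (simp add: card_pow2_interval)
      qed
      also have "\<dots> = sum g U" by (simp add: sumU)
      also have "\<dots> \<le> sum g S" using US finS g by (intro sum_mono2) auto
      also have "\<dots> = s * (real (card S) / 2)" by (simp add: s_def S_def card_pow2_interval)
      finally show ?thesis .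
    qed
    have cardSU: "2 ^ n / 2 \<le> real (card (S - U))"
      using small s US finU finS card_mono[OF finS US]
      by (simp add: card_Diff_subset of_nat_diff S_def card_pow2_interval)
    define D where "D i = cmod (f i - mean S f)" for i
    define R where "R = sum D S"
    have D0: "0 \<le> D i" for i by (simp add: D_def)
    have inner: "(\<Sum>i\<in>X. D i * g i) \<le> 8 * (\<Sum>i\<in>X. F i * G i) + 2 * s * (\<Sum>i\<in>X. D i)" if "X \<in> P" for X
    proof -
      from PX[OF that] obtain k m where X: "m < n" "X = pow2_interval k m" "sum g X \<le> 2 * s * 2 ^ m" by blast
      have cX: "real (card X) = 2 ^ m" using X by (simp add: card_pow2_interval)
      have "(\<Sum>i\<in>X. f i - mean S f) = of_nat (card X) * (mean X f - mean S f)"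
        using cX by (auto simp: sum_subtractf mean_def algebra_simps)
      then have "real (card X) * cmod (mean X f - mean S f) = cmod (\<Sum>i\<in>X. f i - mean S f)"
        by (simp only: norm_mult norm_of_nat)
      then have "2 ^ m * cmod (mean X f - mean S f) = cmod (\<Sum>i\<in>X. f i - mean S f)"
        by (simp only: cX)
      also have "\<dots> \<le> (\<Sum>i\<in>X. D i)" unfolding D_def by (rule norm_sum)
      finally have jump: "2 ^ m * cmod (mean X f - mean S f) \<le> (\<Sum>i\<in>X. D i)" .
      have "(\<Sum>i\<in>X. D i * g i) \<le> (\<Sum>i\<in>X. (cmod (f i - mean X f) + cmod (mean X f - mean S f)) * g i)"
        unfolding D_def
      proof (intro sum_mono mult_right_mono g)
        show "cmod (f i - mean S f) \<le> cmod (f i - mean X f) + cmod (mean X f - mean S f)" for i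
          using norm_triangle_ineq[of "f i - mean X f" "mean X f - mean S f"] by simp
      qed
      also have "\<dots> = (\<Sum>i\<in>X. cmod (f i - mean X f) * g i) + cmod (mean X f - mean S f) * sum g X"
        by (simp add: algebra_simps sum.distrib sum_distrib_left sum_distrib_right)
      also have "\<dots> \<le> 8 * (\<Sum>i\<in>X. F i * G i) + cmod (mean X f - mean S f) * (2 * s * 2 ^ m)"
        using less.IH[OF X(1), of k] X by (intro add_mono mult_left_mono) auto
      also have "cmod (mean X f - mean S f) * (2 * s * 2 ^ m) = 2 * s * (2 ^ m * cmod (mean X f - mean S f))"
        by simp
      also have "\<dots> \<le> 2 * s * (\<Sum>i\<in>X. D i)"
        using s by (intro mult_left_mono jump) auto
      finally show ?thesis by simp
    qed
    have "(\<Sum>i\<in>S. D i * g i) = (\<Sum>i\<in>S - U. D i * g i) + (\<Sum>i\<in>U. D i * g i)"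
      using US finS by (simp add: sum.subset_diff)
    also have "\<dots> \<le> (\<Sum>i\<in>S - U. D i * (2 * s)) + (\<Sum>X\<in>P. 8 * (\<Sum>i\<in>X. F i * G i) + 2 * s * (\<Sum>i\<in>X. D i))"
    proof (intro add_mono)
      have "g i \<le> 2 * s" if "i \<in> S - U" for i
        using bspec[OF P(3) that[unfolded U_def]] s by linarith
      then show "(\<Sum>i\<in>S - U. D i * g i) \<le> (\<Sum>i\<in>S - U. D i * (2 * s))"
        by (intro sum_mono mult_left_mono) (auto simp: D0)
      show "(\<Sum>i\<in>U. D i * g i) \<le> (\<Sum>X\<in>P. 8 * (\<Sum>i\<in>X. F i * G i) + 2 * s * (\<Sum>i\<in>X. D i))"
        unfolding sumU by (intro sum_mono inner)
    qed
    also have "\<dots> = 2 * s * (\<Sum>i\<in>S - U. D i) + 8 * (\<Sum>i\<in>U. F i * G i) + 2 * s * (\<Sum>i\<in>U. D i)"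
      by (simp add: sumU sum.distrib sum_distrib_left mult_ac)
    also have "\<dots> = 2 * s * R + 8 * (\<Sum>i\<in>U. F i * G i)"
      using sum.subset_diff[OF US finS, of D] by (simp add: R_def algebra_simps)
    also have "2 * s * R \<le> 8 * (\<Sum>i\<in>S - U. F i * G i)"
    proof -
      have "(R / 2 ^ n) * (sum g S / 2 ^ n) \<le> F i * G i" if "i \<in> S - U" for i
        using osc[of i l n] avg[of i l n] that pos D0 F[of i] G[of i]
        by (intro mult_mono) (auto simp: S_def R_def D_def divide_le_eq sum_nonneg less_imp_le)
      then have "real (card (S - U)) * ((R / 2 ^ n) * (sum g S / 2 ^ n)) \<le> (\<Sum>i\<in>S - U. F i * G i)"
        using sum_bounded_below[of "S - U" "(R / 2 ^ n) * (sum g S / 2 ^ n)" "\<lambda>i. F i * G i"] by simp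
      moreover have "2 ^ n / 2 * ((R / 2 ^ n) * (sum g S / 2 ^ n))
          \<le> real (card (S - U)) * ((R / 2 ^ n) * (sum g S / 2 ^ n))"
        using cardSU pos D0 by (intro mult_right_mono) (auto simp: R_def sum_nonneg)
      ultimately have "2 ^ n / 2 * ((R / 2 ^ n) * (sum g S / 2 ^ n)) \<le> (\<Sum>i\<in>S - U. F i * G i)"
        by linarith
      then show ?thesis by (simp add: s_def field_simps)
    qed
    finally have "(\<Sum>i\<in>S. D i * g i) \<le> 8 * ((\<Sum>i\<in>S - U. F i * G i) + (\<Sum>i\<in>U. F i * G i))"
      by simp
    also have "\<dots> = 8 * (\<Sum>i\<in>S. F i * G i)"
      using sum.subset_diff[OF US finS, of "\<lambda>i. F i * G i"] by simp
    finally show ?thesis by (simp add: D_def S_def)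
  qed
qed

section \<open>The discrete Hilbert transform on square summable sequences\<close>

text \<open>The truncation of the Hilbert transform to the indices in \<open>A\<close>. The term at \<open>i = j\<close> is zero
  because division by zero gives zero.\<close>

definition partial_hilbert :: "int set \<Rightarrow> (int \<Rightarrow> complex) \<Rightarrow> int \<Rightarrow> complex" where
  "partial_hilbert A a j = (\<Sum>i\<in>A. a i / of_int (i - j))"

text \<open>For \<open>k = 0\<close> the sum vanishes by symmetry, and moving \<open>k\<close> by one exchanges two terms at the ends
  of the range, which tend to zero.\<close>

lemma tendsto_shifted_harmonic:
  fixes k :: int
  shows "(\<lambda>N::nat. \<Sum>j=- int N..int N. 1 / real_of_int (k - j)) \<longlonglongrightarrow> 0"
proof -
  have step: "(\<lambda>N::nat. \<Sum>j=- int N..int N. 1 / real_of_int (int k - j)) \<longlonglongrightarrow> 0" for k :: nat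
  proof (induction k)
    case 0
    have "(\<Sum>j=- int N..int N. 1 / real_of_int (0 - j)) = 0" for N
    proof -
      have "(\<Sum>j=- int N..int N. 1 / real_of_int (0 - j)) = (\<Sum>j=- int N..int N. 1 / real_of_int j)"
        by (rule sum.reindex_bij_witness[of _ uminus uminus]) auto
      moreover have "(\<Sum>j=- int N..int N. 1 / real_of_int (0 - j)) = (\<Sum>j=- int N..int N. - (1 / real_of_int j))"
        by (intro sum.cong) simp_all
      ultimately show ?thesis unfolding sum_negf by linarith
    qed
    then show ?case by simp
  next
    case (Suc k)
    have eq: "(\<Sum>j=- int N..int N. 1 / real_of_int (int (Suc k) - j))
        = (\<Sum>j=- int N..int N. 1 / real_of_int (int k - j)) + 1 / real_of_int (int k + 1 + int N) - 1 / real_of_int (int k - int N)" for N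
    proof -
      have "(\<Sum>j=- int N..int N. 1 / real_of_int (int (Suc k) - j))
          = (\<Sum>j=- int N - 1..int N - 1. 1 / real_of_int (int k - j))"
        by (rule sum.reindex_bij_witness[of _ "\<lambda>j. j + 1" "\<lambda>j. j - 1"]) auto
      also have "\<dots> = (\<Sum>j\<in>insert (- int N - 1) ({- int N..int N} - {int N}). 1 / real_of_int (int k - j))"
        by (rule sum.cong) auto
      also have "\<dots> = 1 / real_of_int (int k + 1 + int N) + (\<Sum>j\<in>{- int N..int N} - {int N}. 1 / real_of_int (int k - j))"
        by (subst sum.insert) (auto simp: algebra_simps)
      also have "(\<Sum>j\<in>{- int N..int N} - {int N}. 1 / real_of_int (int k - j))
          = (\<Sum>j=- int N..int N. 1 / real_of_int (int k - j)) - 1 / real_of_int (int k - int N)"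
        by (subst sum_diff1) auto
      finally show ?thesis by simp
    qed
    have inv: "(\<lambda>N. 1 / (x + real N)) \<longlonglongrightarrow> 0" for x :: real
      by (intro tendsto_divide_0[OF tendsto_const] filterlim_at_top_imp_at_infinity
          filterlim_tendsto_add_at_top[OF tendsto_const] filterlim_real_sequentially)
    have "(\<lambda>N. 1 / real_of_int (int k + 1 + int N)) \<longlonglongrightarrow> 0"
      using inv[of "real k + 1"] by simp
    moreover have "(\<lambda>N. 1 / real_of_int (int k - int N)) \<longlonglongrightarrow> 0"
    proof -
      have "1 / real_of_int (int k - int N) = - (1 / (- real k + real N))" for N
        by (metis minus_diff_eq minus_divide_right of_int_diff of_int_of_nat_eq uminus_add_conv_diff)
      then show ?thesis using tendsto_minus[OF inv[of "- real k"]] by simp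
    qed
    ultimately show ?case unfolding eq using tendsto_diff[OF tendsto_add[OF Suc.IH]] by fastforce
  qed
  show ?thesis
  proof (cases "k \<ge> 0")
    case True
    then show ?thesis using step[of "nat k"] by simp
  next
    case False
    have "(\<Sum>j=- int N..int N. 1 / real_of_int (k - j))
        = - (\<Sum>j=- int N..int N. 1 / real_of_int (int (nat (- k)) - j))" for N
    proof -
      have "(\<Sum>j=- int N..int N. 1 / real_of_int (k - j))
        = (\<Sum>j=- int N..int N. 1 / real_of_int (k + j))"
        by (rule sum.reindex_bij_witness[of _ uminus uminus]) auto
      also have "\<dots> = (\<Sum>j=- int N..int N. - (1 / real_of_int (int (nat (- k)) - j)))"
      proof (intro sum.cong refl)
        fix j
        have "k + j = - (int (nat (- k)) - j)" using False by simp
        then show "1 / real_of_int (k + j) = - (1 / real_of_int (int (nat (- k)) - j))"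
          by (simp only: of_int_minus divide_minus_right)
      qed
      finally show ?thesis by (simp add: sum_negf)
    qed
    then show ?thesis using tendsto_minus[OF step[of "nat (- k)"]] by simp
  qed
qed

lemma sum_inverse_squares_int:
  assumes "finite A"
  shows "(\<Sum>j\<in>A. 1 / (real_of_int (i - j))\<^sup>2) \<le> 4"
proof -
  \<comment> \<open>The term \<open>2 - 1/(N+1)\<close> makes the induction telescope.\<close>
  have nat: "(\<Sum>n=1..Suc N. 1 / (real n)\<^sup>2) \<le> 2 - 1 / real (Suc N)" for N
  proof (induction N)
    case (Suc N)
    have "1 / (real (Suc (Suc N)))\<^sup>2 \<le> 1 / (real (Suc N) * real (Suc (Suc N)))"
      by (intro divide_left_mono) (auto simp: power2_eq_square)
    also have "\<dots> = 1 / real (Suc N) - 1 / real (Suc (Suc N))" by (simp add: divide_simps)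
    finally show ?case using Suc by simp
  qed simp
  have nat2: "(\<Sum>n=1..N. 1 / (real n)\<^sup>2) \<le> 2" for N
  proof (cases N)
    case (Suc M)
    have "0 \<le> 1 / real (Suc M)" by simp
    then show ?thesis using nat[of M] unfolding Suc by linarith
  qed simp
  define h where "h j = 1 / (real_of_int (i - j))\<^sup>2" for j
  have "bdd_above ((\<lambda>j. \<bar>i - j\<bar>) ` A)" using assms by simp
  then obtain M where M: "\<And>j. j \<in> A \<Longrightarrow> \<bar>i - j\<bar> \<le> M" by (auto simp: bdd_above_def)
  define N where "N = nat M"
  define B where "B = insert i ((\<lambda>n. i + int n) ` {1..N} \<union> (\<lambda>n. i - int n) ` {1..N})"
  have "A \<subseteq> B"
  proof
    fix j assume j: "j \<in> A"
    show "j \<in> B"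
    proof (cases j i rule: linorder_cases)
      case less
      then have "j = i - int (nat (i - j))" "nat (i - j) \<in> {1..N}"
        using M[OF j] unfolding N_def atLeastAtMost_iff by arith+
      then show ?thesis unfolding B_def by blast
    next
      case greater
      then have "j = i + int (nat (j - i))" "nat (j - i) \<in> {1..N}"
        using M[OF j] unfolding N_def atLeastAtMost_iff by arith+
      then show ?thesis unfolding B_def by blast
    qed (simp add: B_def)
  qed
  then have "sum h A \<le> sum h B" by (intro sum_mono2) (auto simp: B_def h_def)
  also have "\<dots> \<le> h i + (sum h ((\<lambda>n. i + int n) ` {1..N}) + sum h ((\<lambda>n. i - int n) ` {1..N}))"
    unfolding B_def
    by (subst sum.insert_if, simp, subst sum.union_inter[symmetric]) (auto simp: h_def intro!: sum_nonneg add_nonneg_nonneg)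
  also have "\<dots> = 2 * (\<Sum>n=1..N. 1 / (real n)\<^sup>2)"
    by (subst (1 2) sum.reindex) (auto simp: inj_on_def h_def)
  also have "\<dots> \<le> 4" using nat2[of N] by simp
  finally show ?thesis by (simp add: h_def)
qed

text \<open>The off-diagonal entries of \<open>H\<^sup>* H\<close>. By partial fractions the product is
  \<open>1/(i - k)\<close> times the difference of two shifted harmonic sums, whose limits vanish. The entire
  limit comes from the terms \<open>j = i\<close> and \<open>j = k\<close>, where the product is zero but the partial
  fractions are not.\<close>

lemma tendsto_hilbert_kernel:
  fixes i k :: int
  assumes "i \<noteq> k"
  shows "(\<lambda>N::nat. \<Sum>j=- int N..int N. (1 / real_of_int (i - j)) * (1 / real_of_int (k - j)))
     \<longlonglongrightarrow> 2 / (real_of_int (i - k))\<^sup>2"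
proof -
  define d where "d = real_of_int (i - k)"
  have d: "d \<noteq> 0" using assms by (simp add: d_def)
  have pf: "(1 / real_of_int (i - j)) * (1 / real_of_int (k - j)) =
      (1 / d) * (1 / real_of_int (k - j) - 1 / real_of_int (i - j)
         + (if j = i then 1 / d else 0) + (if j = k then 1 / d else 0))" for j
  proof -
    consider "j = i" | "j = k" | "j \<noteq> i" "j \<noteq> k" by blast
    then show ?thesis
    proof cases
      case 3
      define x where "x = real_of_int (i - j)"
      define y where "y = real_of_int (k - j)"
      have "d = x - y" "x \<noteq> 0" "y \<noteq> 0" using 3 by (auto simp: d_def x_def y_def)
      then show ?thesis using 3 d unfolding x_def[symmetric] y_def[symmetric] by (simp add: field_simps)
    qed (use assms in \<open>auto simp: d_def field_simps\<close>)
  qed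
  have "(\<lambda>N::nat. (1 / d) * ((\<Sum>j=- int N..int N. 1 / real_of_int (k - j))
        - (\<Sum>j=- int N..int N. 1 / real_of_int (i - j)) + 1 / d + 1 / d))
      \<longlonglongrightarrow> (1 / d) * (0 - 0 + 1 / d + 1 / d)"
    by (intro tendsto_intros tendsto_shifted_harmonic)
  moreover have "\<forall>\<^sub>F N in sequentially. (1 / d) * ((\<Sum>j=- int N..int N. 1 / real_of_int (k - j))
        - (\<Sum>j=- int N..int N. 1 / real_of_int (i - j)) + 1 / d + 1 / d)
      = (\<Sum>j=- int N..int N. (1 / real_of_int (i - j)) * (1 / real_of_int (k - j)))"
    using eventually_ge_at_top[of "nat (\<bar>i\<bar> + \<bar>k\<bar>)"]
  proof eventually_elim
    case (elim N)
    then have "i \<in> {- int N..int N}" "k \<in> {- int N..int N}" by auto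
    then show ?case
      unfolding pf by (simp add: sum_divide_distrib[symmetric] sum.distrib sum_subtractf del: of_int_diff)
  qed
  ultimately have "(\<lambda>N::nat. \<Sum>j=- int N..int N. (1 / real_of_int (i - j)) * (1 / real_of_int (k - j)))
      \<longlonglongrightarrow> (1 / d) * (0 - 0 + 1 / d + 1 / d)"
    by (rule Lim_transform_eventually)
  moreover have "(1 / d) * (0 - 0 + 1 / d + 1 / d) = 2 / d\<^sup>2"
    using d by (simp add: power2_eq_square)
  ultimately show ?thesis by (simp only: d_def)
qed

text \<open>The kernel of \<open>H\<^sup>* H\<close> is at most \<open>4\<close> on the diagonal and \<open>2/(i - k)\<^sup>2\<close> off it.
  The sum of each row is therefore at most \<open>4 + 2 * 4 = 12\<close>, and Schur's test applies.\<close>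

lemma partial_hilbert_l2:
  assumes A: "finite A" and E: "finite E"
  shows "(\<Sum>j\<in>E. (cmod (partial_hilbert A a j))\<^sup>2) \<le> 12 * (\<Sum>i\<in>A. (cmod (a i))\<^sup>2)"
proof -
  define c where "c N i k = (\<Sum>j=- int N..int N. (1 / real_of_int (i - j)) * (1 / real_of_int (k - j)))"
    for N :: nat and i k :: int
  define c0 where "c0 i k = (if i = k then 4 else 2 / (real_of_int (i - k))\<^sup>2)" for i k :: int
  have c0: "0 \<le> c0 i k" "c0 i k = c0 k i" for i k by (auto simp: c0_def power2_commute)
  have row: "(\<Sum>k\<in>A. c0 i k) \<le> 12" for i
  proof -
    have "(\<Sum>k\<in>A. c0 i k) \<le> (\<Sum>k\<in>A. (if k = i then 4 else 0) + 2 * (1 / (real_of_int (i - k))\<^sup>2))"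
      by (intro sum_mono) (auto simp: c0_def)
    also have "\<dots> \<le> 4 + 2 * 4"
      unfolding sum.distrib sum_distrib_left[symmetric]
      using A by (intro add_mono mult_left_mono sum_inverse_squares_int) auto
    finally show ?thesis by simp
  qed
  have schur: "(\<Sum>i\<in>A. \<Sum>k\<in>A. cmod (a i) * cmod (a k) * c0 i k) \<le> 12 * (\<Sum>i\<in>A. (cmod (a i))\<^sup>2)"
  proof -
    have "(\<Sum>i\<in>A. \<Sum>k\<in>A. cmod (a i) * cmod (a k) * c0 i k)
        \<le> (\<Sum>i\<in>A. \<Sum>k\<in>A. ((cmod (a i))\<^sup>2 / 2 + (cmod (a k))\<^sup>2 / 2) * c0 i k)"
    proof (intro sum_mono mult_right_mono c0)
      fix i k
      have "0 \<le> (cmod (a i) - cmod (a k))\<^sup>2" by simp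
      then show "cmod (a i) * cmod (a k) \<le> (cmod (a i))\<^sup>2 / 2 + (cmod (a k))\<^sup>2 / 2"
        by (simp add: power2_diff)
    qed
    also have "\<dots> = (\<Sum>i\<in>A. \<Sum>k\<in>A. (cmod (a i))\<^sup>2 / 2 * c0 i k) + (\<Sum>i\<in>A. \<Sum>k\<in>A. (cmod (a k))\<^sup>2 / 2 * c0 i k)"
      by (simp add: distrib_right sum.distrib)
    also have "(\<Sum>i\<in>A. \<Sum>k\<in>A. (cmod (a k))\<^sup>2 / 2 * c0 i k) = (\<Sum>i\<in>A. \<Sum>k\<in>A. (cmod (a i))\<^sup>2 / 2 * c0 i k)"
      by (subst sum.swap) (simp add: c0(2))
    also have "\<dots> + \<dots> = (\<Sum>i\<in>A. (cmod (a i))\<^sup>2 * (\<Sum>k\<in>A. c0 i k))"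
      by (simp add: sum_distrib_left sum_distrib_right sum.distrib[symmetric] mult.commute)
    also have "\<dots> \<le> (\<Sum>i\<in>A. (cmod (a i))\<^sup>2 * 12)" by (intro sum_mono mult_left_mono row) auto
    finally show ?thesis by (simp add: sum_distrib_left mult.commute)
  qed
  \<comment> \<open>The diagonal is replaced by its bound, so that only the off-diagonal entries need a limit.\<close>
  define c1 where "c1 N i k = (if i = k then 4 else \<bar>c N i k\<bar>)" for N i k
  have expand: "(\<Sum>j=- int N..int N. (cmod (partial_hilbert A a j))\<^sup>2)
     \<le> (\<Sum>i\<in>A. \<Sum>k\<in>A. cmod (a i) * cmod (a k) * c1 N i k)" for N
  proof -
    have "complex_of_real (\<Sum>j=- int N..int N. (cmod (partial_hilbert A a j))\<^sup>2)
        = (\<Sum>j=- int N..int N. \<Sum>i\<in>A. \<Sum>k\<in>A. (a i / of_int (i - j)) * cnj (a k / of_int (k - j)))"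
      unfolding of_real_sum complex_norm_square partial_hilbert_def cnj_sum sum_product by (rule refl)
    also have "\<dots> = (\<Sum>i\<in>A. \<Sum>j=- int N..int N. \<Sum>k\<in>A. (a i / of_int (i - j)) * cnj (a k / of_int (k - j)))"
      by (rule sum.swap)
    also have "\<dots> = (\<Sum>i\<in>A. \<Sum>k\<in>A. \<Sum>j=- int N..int N. (a i / of_int (i - j)) * cnj (a k / of_int (k - j)))"
      by (intro sum.cong refl sum.swap)
    also have "\<dots> = (\<Sum>i\<in>A. \<Sum>k\<in>A. a i * cnj (a k) * of_real (c N i k))"
      by (intro sum.cong refl) (simp add: c_def sum_distrib_left del: of_int_diff)
    finally have eq: "complex_of_real (\<Sum>j=- int N..int N. (cmod (partial_hilbert A a j))\<^sup>2)
        = (\<Sum>i\<in>A. \<Sum>k\<in>A. a i * cnj (a k) * of_real (c N i k))" .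
    have cc: "\<bar>c N i k\<bar> \<le> c1 N i k" for i k
    proof (cases "i = k")
      case True
      have "c N i i = (\<Sum>j=- int N..int N. 1 / (real_of_int (i - j))\<^sup>2)"
        by (simp add: c_def power2_eq_square)
      moreover have "0 \<le> \<dots>" by (intro sum_nonneg) auto
      moreover have "(\<Sum>j=- int N..int N. 1 / (real_of_int (i - j))\<^sup>2) \<le> 4"
        by (rule sum_inverse_squares_int) simp
      ultimately show ?thesis using True by (simp add: c1_def)
    qed (simp add: c1_def)
    have "(\<Sum>j=- int N..int N. (cmod (partial_hilbert A a j))\<^sup>2)
        = cmod (complex_of_real (\<Sum>j=- int N..int N. (cmod (partial_hilbert A a j))\<^sup>2))"
      unfolding norm_of_real by (simp add: sum_nonneg)
    also have "\<dots> \<le> (\<Sum>i\<in>A. \<Sum>k\<in>A. cmod (a i * cnj (a k) * of_real (c N i k)))"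
      unfolding eq by (intro order_trans[OF norm_sum] sum_mono) auto
    also have "\<dots> \<le> (\<Sum>i\<in>A. \<Sum>k\<in>A. cmod (a i) * cmod (a k) * c1 N i k)"
      unfolding norm_mult complex_mod_cnj norm_of_real
      by (intro sum_mono mult_left_mono cc) auto
    finally show ?thesis .
  qed
  have "(\<lambda>N. \<Sum>i\<in>A. \<Sum>k\<in>A. cmod (a i) * cmod (a k) * c1 N i k)
      \<longlonglongrightarrow> (\<Sum>i\<in>A. \<Sum>k\<in>A. cmod (a i) * cmod (a k) * c0 i k)"
  proof (intro tendsto_sum tendsto_mult tendsto_const)
    show "(\<lambda>N. c1 N i k) \<longlonglongrightarrow> c0 i k" for i k
    proof (cases "i = k")
      case False
      then have "(\<lambda>N. \<bar>c N i k\<bar>) \<longlonglongrightarrow> \<bar>2 / (real_of_int (i - k))\<^sup>2\<bar>"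
        unfolding c_def by (intro tendsto_rabs tendsto_hilbert_kernel)
      then show ?thesis using False by (simp add: c1_def c0_def)
    qed (simp add: c1_def c0_def)
  qed
  moreover have "\<forall>\<^sub>F N in sequentially. (\<Sum>j\<in>E. (cmod (partial_hilbert A a j))\<^sup>2)
      \<le> (\<Sum>i\<in>A. \<Sum>k\<in>A. cmod (a i) * cmod (a k) * c1 N i k)"
  proof -
    have "bdd_above (abs ` E)" using E by simp
    then obtain M where M: "\<And>j. j \<in> E \<Longrightarrow> \<bar>j\<bar> \<le> M" by (auto simp: bdd_above_def)
    show ?thesis
      using eventually_ge_at_top[of "nat M"]
    proof eventually_elim
      case (elim N)
      have "E \<subseteq> {- int N..int N}" using M elim by force
      then have "(\<Sum>j\<in>E. (cmod (partial_hilbert A a j))\<^sup>2)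
          \<le> (\<Sum>j=- int N..int N. (cmod (partial_hilbert A a j))\<^sup>2)" by (intro sum_mono2) auto
      then show ?case using expand[of N] by simp
    qed
  qed
  ultimately have "(\<Sum>j\<in>E. (cmod (partial_hilbert A a j))\<^sup>2)
      \<le> (\<Sum>i\<in>A. \<Sum>k\<in>A. cmod (a i) * cmod (a k) * c0 i k)"
    by (intro tendsto_lowerbound) auto
  then show ?thesis using schur by simp
qed

text \<open>A square summable sequence has means of order \<open>2\<^bsup>-n/2\<^esup>\<close> over intervals of length \<open>2\<^sup>n\<close>. This
  removes the mean from \<open>sharp_duality\<close> on large intervals.\<close>

lemma tendsto_mean_partial_hilbert:
  assumes A: "finite A"
  shows "(\<lambda>n. cmod (mean (pow2_interval l n) (partial_hilbert A a))) \<longlonglongrightarrow> 0"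
proof -
  define M where "M = 12 * (\<Sum>i\<in>A. (cmod (a i))\<^sup>2)"
  have M: "0 \<le> M" by (simp add: M_def sum_nonneg)
  have le: "cmod (mean (pow2_interval l n) (partial_hilbert A a)) \<le> sqrt (M / 2 ^ n)" for n
  proof -
    have ne: "pow2_interval l n \<noteq> {}" by (simp add: pow2_interval_def)
    have "(\<Sum>i\<in>pow2_interval l n. cmod (partial_hilbert A a i)) \<le> sqrt (M / 2 ^ n) * real (card (pow2_interval l n))"
    proof (rule power_mean_le[where q = 2])
      have "(\<Sum>i\<in>pow2_interval l n. cmod (partial_hilbert A a i) powr 2) = (\<Sum>i\<in>pow2_interval l n. (cmod (partial_hilbert A a i))\<^sup>2)"
        by simp
      also have "\<dots> \<le> M" unfolding M_def by (rule partial_hilbert_l2) (use A in auto)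
      also have "M = sqrt (M / 2 ^ n) powr 2 * real (card (pow2_interval l n))"
        using M by (simp add: card_pow2_interval)
      finally show "(\<Sum>i\<in>pow2_interval l n. cmod (partial_hilbert A a i) powr 2)
          \<le> sqrt (M / 2 ^ n) powr 2 * real (card (pow2_interval l n))" .
    qed (use ne M in auto)
    then have "cmod (\<Sum>i\<in>pow2_interval l n. partial_hilbert A a i) \<le> sqrt (M / 2 ^ n) * real (card (pow2_interval l n))"
      using norm_sum order_trans by blast
    then show ?thesis
      by (simp add: mean_def norm_divide card_pow2_interval divide_le_eq)
  qed
  have "(\<lambda>n. sqrt (M / 2 ^ n)) \<longlonglongrightarrow> sqrt 0"
    by (intro tendsto_real_sqrt LIMSEQ_divide_realpow_zero) simp
  then have lim: "(\<lambda>n. sqrt (M / 2 ^ n)) \<longlonglongrightarrow> 0" by simp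
  show ?thesis
    by (rule tendsto_sandwich[OF _ _ tendsto_const lim]) (use le in auto)
qed

section \<open>Oscillation of the Hilbert transform\<close>

lemma dyadic_annulus:
  fixes L d :: real
  assumes "0 < L" "L \<le> d"
  shows "\<exists>k::nat. 2 ^ k * L \<le> d \<and> d < 2 ^ Suc k * L"
proof -
  have "\<exists>n::nat. d / L < 2 ^ n" using real_arch_pow[of 2 "d / L"] by auto
  then have ex: "\<exists>n::nat. d < 2 ^ n * L" using assms by (simp add: divide_less_eq)
  define n where "n = (LEAST n::nat. d < 2 ^ n * L)"
  have n: "d < 2 ^ n * L" unfolding n_def using ex by (rule LeastI_ex)
  moreover have "n \<noteq> 0" using n assms by (cases n) auto
  then obtain k where k: "n = Suc k" by (cases n) auto
  have "\<not> d < 2 ^ k * L" using not_less_Least[of k "\<lambda>n. d < 2 ^ n * L"] k by (simp add: n_def)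
  ultimately show ?thesis using k by (intro exI[of _ k]) auto
qed

text \<open>Split the distance \<open>|i - l|\<close> into the ranges from \<open>2\<^sup>k 2\<^sup>n\<close> to \<open>2\<^bsup>k+1\<^esup> 2\<^sup>n\<close>. On each of
  them the sum of \<open>b\<close> is at most \<open>y\<close> times the length of the surrounding interval, which leaves a geometric
  series in \<open>k\<close>.\<close>

lemma far_sum_le:
  fixes b :: "int \<Rightarrow> real" and l :: int
  assumes A: "finite A" and b: "\<And>i. 0 \<le> b i" and far: "\<And>i. i \<in> A \<Longrightarrow> 2 ^ n \<le> \<bar>i - l\<bar>"
    and avg: "\<And>k. (\<Sum>i\<in>A \<inter> {l - 2 ^ k * 2 ^ n..<l + 2 ^ k * 2 ^ n}. b i) \<le> y * (2 * (2 ^ k * 2 ^ n))"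
    and y: "0 \<le> y"
  shows "(\<Sum>i\<in>A. b i / (real_of_int (i - l))\<^sup>2) \<le> 8 * y / 2 ^ n"
proof -
  define L :: real where "L = 2 ^ n"
  have L: "L > 0" by (simp add: L_def)
  have "\<exists>k::nat. 2 ^ k * L \<le> \<bar>real_of_int (i - l)\<bar> \<and> \<bar>real_of_int (i - l)\<bar> < 2 ^ Suc k * L" if "i \<in> A" for i
  proof (rule dyadic_annulus[OF L])
    have "real_of_int (2 ^ n) \<le> real_of_int \<bar>i - l\<bar>" using far[OF that] by (simp only: of_int_le_iff)
    then show "L \<le> \<bar>real_of_int (i - l)\<bar>" by (simp add: L_def)
  qed
  then obtain k where k: "\<And>i. i \<in> A \<Longrightarrow> 2 ^ k i * L \<le> \<bar>real_of_int (i - l)\<bar>"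
      "\<And>i. i \<in> A \<Longrightarrow> \<bar>real_of_int (i - l)\<bar> < 2 ^ Suc (k i) * L" by metis
  define K where "K = Suc (Max (insert 0 (k ` A)))"
  have kK: "k i < K" if "i \<in> A" for i
    using A that by (auto simp: K_def less_Suc_eq_le)
  \<comment> \<open>The \<open>j\<close>-th interval also contains the nearer points, which only enlarges the sum.\<close>
  define B where "B j = A \<inter> {l - 2 ^ Suc j * 2 ^ n..<l + 2 ^ Suc j * 2 ^ n}" for j :: nat
  have mem: "i \<in> B (k i)" if "i \<in> A" for i
  proof -
    have "real_of_int \<bar>i - l\<bar> < real_of_int (2 ^ Suc (k i) * 2 ^ n)"
      using k(2)[OF that] by (simp add: L_def)
    then have "\<bar>i - l\<bar> < 2 ^ Suc (k i) * 2 ^ n" by (simp only: of_int_less_iff)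
    then show ?thesis using that by (auto simp: B_def)
  qed
  have "(\<Sum>i\<in>A. b i / (real_of_int (i - l))\<^sup>2) \<le> (\<Sum>i\<in>A. \<Sum>j<K. if i \<in> B j then b i / (2 ^ j * L)\<^sup>2 else 0)"
  proof (rule sum_mono)
    fix i assume i: "i \<in> A"
    have "(2 ^ k i * L)\<^sup>2 \<le> (real_of_int (i - l))\<^sup>2"
      using k(1)[OF i] L by (intro abs_le_square_iff[THEN iffD1]) auto
    then have "b i / (real_of_int (i - l))\<^sup>2 \<le> b i / (2 ^ k i * L)\<^sup>2"
      using L b by (intro divide_left_mono mult_pos_pos) (auto intro: less_le_trans[rotated])
    also have "\<dots> = (if i \<in> B (k i) then b i / (2 ^ k i * L)\<^sup>2 else 0)" using mem[OF i] by simp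
    also have "\<dots> \<le> (\<Sum>j<K. if i \<in> B j then b i / (2 ^ j * L)\<^sup>2 else 0)"
      using kK[OF i] b by (intro member_le_sum) auto
    finally show "b i / (real_of_int (i - l))\<^sup>2 \<le> (\<Sum>j<K. if i \<in> B j then b i / (2 ^ j * L)\<^sup>2 else 0)" .
  qed
  also have "\<dots> = (\<Sum>j<K. (\<Sum>i\<in>B j. b i) / (2 ^ j * L)\<^sup>2)"
  proof (subst sum.swap, intro sum.cong refl)
    fix j
    have "{i \<in> A. i \<in> B j} = B j" by (auto simp: B_def)
    then show "(\<Sum>i\<in>A. if i \<in> B j then b i / (2 ^ j * L)\<^sup>2 else 0) = (\<Sum>i\<in>B j. b i) / (2 ^ j * L)\<^sup>2"
      using A by (simp add: sum.inter_filter[symmetric] sum_divide_distrib)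
  qed
  also have "\<dots> \<le> (\<Sum>j<K. (4 * y / L) * (1/2) ^ j)"
  proof (rule sum_mono)
    fix j
    have "(\<Sum>i\<in>B j. b i) / (2 ^ j * L)\<^sup>2 \<le> y * (2 * (2 ^ Suc j * L)) / (2 ^ j * L)\<^sup>2"
      using avg[of "Suc j"] by (intro divide_right_mono) (auto simp: B_def L_def)
    also have "\<dots> = (4 * y / L) * (1/2) ^ j"
      using L by (simp add: power2_eq_square field_simps)
    finally show "(\<Sum>i\<in>B j. b i) / (2 ^ j * L)\<^sup>2 \<le> (4 * y / L) * (1/2) ^ j" .
  qed
  also have "\<dots> = (4 * y / L) * (\<Sum>j<K. (1/2) ^ j)" by (simp add: sum_distrib_left)
  also have "\<dots> \<le> (4 * y / L) * 2"
  proof (rule mult_left_mono)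
    show "(\<Sum>j<K. (1/2::real) ^ j) \<le> 2" by (simp add: geometric_sum)
  qed (use L y in auto)
  finally show ?thesis by (simp add: L_def)
qed

definition lp_bound :: "real \<Rightarrow> real \<Rightarrow> bool" where
  "lp_bound q C \<longleftrightarrow> 0 \<le> C \<and> (\<forall>A E a. finite A \<longrightarrow> finite E \<longrightarrow>
     (\<Sum>j\<in>E. cmod (partial_hilbert A a j) powr q) \<le> C * (\<Sum>i\<in>A. cmod (a i) powr q))"

lemma lp_boundD:
  assumes "lp_bound q C" "finite A" "finite E"
  shows "(\<Sum>j\<in>E. cmod (partial_hilbert A a j) powr q) \<le> C * (\<Sum>i\<in>A. cmod (a i) powr q)"
  using assms by (simp add: lp_bound_def)

text \<open>The part of \<open>a\<close> on the threefold enlargement of the interval is handled by the \<open>\<ell>\<^sup>q\<close>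
  bound. For the remaining part the kernel is smooth: the difference of its values at \<open>l\<close> and at another point of the
  interval is at most \<open>2 2\<^sup>n / (i - l)\<^sup>2\<close>, so \<open>far_sum_le\<close> bounds the deviation from the value at \<open>l\<close>.\<close>

lemma partial_hilbert_oscillation:
  assumes q: "q \<ge> 1" and C: "lp_bound q C" and A: "finite A" and x: "x \<in> pow2_interval l n" and y: "0 \<le> y"
    and avg: "\<And>m k. m \<le> x \<Longrightarrow> x < k \<Longrightarrow> (\<Sum>i\<in>A \<inter> {m..<k}. cmod (a i) powr q) \<le> y powr q * real_of_int (k - m)"
  shows "(\<Sum>i\<in>pow2_interval l n. cmod (partial_hilbert A a i - mean (pow2_interval l n) (partial_hilbert A a)))
     \<le> 2 * ((3 * C) powr (1/q) + 16) * y * 2 ^ n"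
proof -
  define L :: int where "L = 2 ^ n"
  have L: "L > 0" "real_of_int L = 2 ^ n" by (simp_all add: L_def)
  have x': "l \<le> x" "x < l + L" using x by (auto simp: pow2_interval_def L_def)
  have C0: "0 \<le> C" using C by (simp add: lp_bound_def)
  define Q where "Q = pow2_interval l n"
  have Q: "finite Q" "Q \<noteq> {}" "real (card Q) = 2 ^ n" using x card_pow2_interval by (auto simp: Q_def)
  define N where "N = {l - L..<l + 2 * L}"
  define f1 where "f1 = partial_hilbert (A \<inter> N) a"
  define f2 where "f2 = partial_hilbert (A - N) a"
  have split: "partial_hilbert A a j = f1 j + f2 j" for j
    unfolding partial_hilbert_def f1_def f2_def using A by (rule sum.Int_Diff)
  have near: "(\<Sum>j\<in>Q. cmod (f1 j)) \<le> ((3 * C) powr (1/q) * y) * real (card Q)"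
  proof (rule power_mean_le[OF Q(1,2) q])
    have "(\<Sum>j\<in>Q. cmod (f1 j) powr q) \<le> C * (\<Sum>i\<in>A \<inter> N. cmod (a i) powr q)"
      unfolding f1_def using A Q by (intro lp_boundD[OF C]) auto
    also have "\<dots> \<le> C * (y powr q * real_of_int ((l + 2 * L) - (l - L)))"
      unfolding N_def using x' L by (intro mult_left_mono avg C0) auto
    also have "\<dots> = ((3 * C) powr (1/q) * y) powr q * real (card Q)"
      using q C0 y L Q by (simp add: powr_mult powr_powr powr_one)
    finally show "(\<Sum>j\<in>Q. cmod (f1 j) powr q) \<le> ((3 * C) powr (1/q) * y) powr q * real (card Q)" .
  qed (use y in auto)
  have farsum: "(\<Sum>i\<in>A - N. cmod (a i) / (real_of_int (i - l))\<^sup>2) \<le> 8 * y / 2 ^ n"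
  proof (rule far_sum_le)
    show "2 ^ n \<le> \<bar>i - l\<bar>" if "i \<in> A - N" for i
      using that L by (auto simp: N_def L_def[symmetric])
    fix k :: nat
    define I where "I = {l - 2 ^ k * 2 ^ n..<l + 2 ^ k * 2 ^ n}"
    have "L \<le> 2 ^ k * 2 ^ n" using L by (simp add: L_def)
    then have I: "l - 2 ^ k * 2 ^ n \<le> x" "x < l + 2 ^ k * 2 ^ n" using x' L(1) by linarith+
    define b where "b i = (if i \<in> A then cmod (a i) else 0)" for i
    have cI: "real (card I) = 2 * (2 ^ k * 2 ^ n)" by (simp add: I_def)
    have "(\<Sum>i\<in>I. b i) \<le> y * real (card I)"
    proof (rule power_mean_le)
      have "(\<Sum>i\<in>I. b i powr q) = (\<Sum>i\<in>A \<inter> I. cmod (a i) powr q)"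
        using q by (intro sum.mono_neutral_cong_right) (auto simp: b_def I_def)
      also have "\<dots> \<le> y powr q * real_of_int ((l + 2 ^ k * 2 ^ n) - (l - 2 ^ k * 2 ^ n))"
        unfolding I_def by (rule avg[OF I])
      finally show "(\<Sum>i\<in>I. b i powr q) \<le> y powr q * real (card I)" by (simp add: cI)
    qed (use q y I in \<open>auto simp: I_def b_def\<close>)
    moreover have "(\<Sum>i\<in>(A - N) \<inter> I. cmod (a i)) \<le> (\<Sum>i\<in>I. b i)"
    proof -
      have "(\<Sum>i\<in>(A - N) \<inter> I. cmod (a i)) = (\<Sum>i\<in>(A - N) \<inter> I. b i)" by (rule sum.cong) (auto simp: b_def)
      also have "\<dots> \<le> (\<Sum>i\<in>I. b i)" by (intro sum_mono2) (auto simp: b_def I_def)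
      finally show ?thesis .
    qed
    ultimately show "(\<Sum>i\<in>(A - N) \<inter> {l - 2 ^ k * 2 ^ n..<l + 2 ^ k * 2 ^ n}. cmod (a i)) \<le> y * (2 * (2 ^ k * 2 ^ n))"
      unfolding I_def[symmetric] cI by linarith
  qed (use A y in auto)
  have far: "cmod (f2 j - f2 l) \<le> 16 * y" if j: "j \<in> Q" for j
  proof -
    have j': "l \<le> j" "j < l + L" using j by (auto simp: Q_def pow2_interval_def L_def)
    have "cmod (f2 j - f2 l) \<le> (\<Sum>i\<in>A - N. cmod (a i / of_int (i - j) - a i / of_int (i - l)))"
      unfolding f2_def partial_hilbert_def sum_subtractf[symmetric] by (rule norm_sum)
    also have "\<dots> \<le> (\<Sum>i\<in>A - N. 2 * 2 ^ n * (cmod (a i) / (real_of_int (i - l))\<^sup>2))"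
    proof (rule sum_mono)
      fix i assume i: "i \<in> A - N"
      define u where "u = real_of_int (i - j)"
      define v where "v = real_of_int (i - l)"
      have ij: "i < l - L \<or> l + 2 * L \<le> i" using i by (auto simp: N_def)
      \<comment> \<open>Outside the enlarged interval, moving the base point from \<open>l\<close> to \<open>j\<close> at most halves the distance.\<close>
      have "\<bar>i - l\<bar> \<le> 2 * \<bar>i - j\<bar>" using ij j' L by auto
      then have uv: "\<bar>v\<bar> \<le> 2 * \<bar>u\<bar>" unfolding u_def v_def by linarith
      have v0: "v \<noteq> 0" "u \<noteq> 0" using ij j' L by (auto simp: u_def v_def)
      have "\<bar>real_of_int (j - l)\<bar> \<le> real_of_int L" using j' by linarith
      then have vu: "\<bar>v - u\<bar> \<le> 2 ^ n" unfolding L(2) by (simp add: u_def v_def)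
      have "a i / of_int (i - j) - a i / of_int (i - l) = a i * of_real (1 / u - 1 / v)"
        by (simp add: u_def v_def field_simps del: of_int_diff)
      then have diff: "cmod (a i / of_int (i - j) - a i / of_int (i - l)) = cmod (a i) * \<bar>1 / u - 1 / v\<bar>"
        by (simp only: norm_mult norm_of_real)
      have "\<bar>1 / u - 1 / v\<bar> = \<bar>v - u\<bar> / (\<bar>u\<bar> * \<bar>v\<bar>)"
      proof -
        have "1 / u - 1 / v = (v - u) / (u * v)" using v0 by (simp add: field_simps)
        then show ?thesis by (simp only: abs_divide abs_mult)
      qed
      also have "\<dots> \<le> 2 ^ n / (\<bar>v\<bar> / 2 * \<bar>v\<bar>)"
        using uv v0 vu by (intro frac_le mult_right_mono mult_pos_pos) auto
      also have "\<dots> = 2 * 2 ^ n / v\<^sup>2" by (simp add: power2_eq_square abs_mult[symmetric])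
      finally have "cmod (a i) * \<bar>1 / u - 1 / v\<bar> \<le> cmod (a i) * (2 * 2 ^ n / v\<^sup>2)"
        by (rule mult_left_mono) simp
      then show "cmod (a i / of_int (i - j) - a i / of_int (i - l)) \<le> 2 * 2 ^ n * (cmod (a i) / (real_of_int (i - l))\<^sup>2)"
        unfolding diff v_def[symmetric] by (simp add: mult_ac)
    qed
    also have "\<dots> = 2 * 2 ^ n * (\<Sum>i\<in>A - N. cmod (a i) / (real_of_int (i - l))\<^sup>2)"
      by (simp add: sum_distrib_left del: of_int_diff)
    also have "\<dots> \<le> 2 * 2 ^ n * (8 * y / 2 ^ n)" by (intro mult_left_mono farsum) auto
    finally show ?thesis by simp
  qed
  have "(\<Sum>j\<in>Q. cmod (partial_hilbert A a j - f2 l)) \<le> (\<Sum>j\<in>Q. cmod (f1 j) + 16 * y)"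
  proof (rule sum_mono)
    fix j assume j: "j \<in> Q"
    have eq: "partial_hilbert A a j - f2 l = f1 j + (f2 j - f2 l)" by (simp add: split)
    show "cmod (partial_hilbert A a j - f2 l) \<le> cmod (f1 j) + 16 * y"
      unfolding eq using norm_triangle_ineq[of "f1 j" "f2 j - f2 l"] far[OF j] by linarith
  qed
  also have "\<dots> \<le> ((3 * C) powr (1/q) + 16) * y * 2 ^ n"
    using near Q(3) by (simp add: sum.distrib algebra_simps)
  finally have "2 * (\<Sum>j\<in>Q. cmod (partial_hilbert A a j - f2 l)) \<le> 2 * (((3 * C) powr (1/q) + 16) * y * 2 ^ n)"
    by (rule mult_left_mono) simp
  from order_trans[OF sum_deviation_mean_le[OF Q(1,2), of "partial_hilbert A a" "f2 l"] this]
  show ?thesis unfolding Q_def by (simp only: mult.assoc)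
qed

section \<open>Muckenhoupt weights\<close>

definition A1_weight :: "real \<Rightarrow> (int \<Rightarrow> real) \<Rightarrow> bool" where
  "A1_weight K W \<longleftrightarrow> (\<forall>i. 0 < W i) \<and>
     (\<forall>m n x. m \<le> x \<longrightarrow> x \<le> n \<longrightarrow> (\<Sum>i=m..n. W i) \<le> K * real_of_int (n - m + 1) * W x)"

lemma A1_weightD:
  assumes "A1_weight K W"
  shows "0 < W i"
    and "m \<le> x \<Longrightarrow> x \<le> n \<Longrightarrow> (\<Sum>i=m..n. W i) \<le> K * real_of_int (n - m + 1) * W x"
  using assms by (auto simp: A1_weight_def)

lemma A1_weight_pos:
  assumes "A1_weight K W"
  shows "0 < K"
  using A1_weightD(2)[OF assms, of 0 0 0] A1_weightD(1)[OF assms, of 0] by (simp add: zero_less_mult_iff)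

text \<open>On an interval an \<open>A\<^sub>1\<close> weight is bounded below by its average divided by \<open>K\<close>; hence averages
  with respect to counting measure are dominated by averages with respect to \<open>W\<close>.\<close>

lemma A1_average_le:
  assumes W: "A1_weight K W" and g: "\<And>i. 0 \<le> g i" and mn: "m \<le> n"
    and avg: "(\<Sum>i=m..n. g i * W i) \<le> z * (\<Sum>i=m..n. W i)"
  shows "(\<Sum>i=m..n. g i) \<le> K * z * real_of_int (n - m + 1)"
proof -
  define S where "S = (\<Sum>i=m..n. W i)"
  have S: "0 < S" unfolding S_def using mn A1_weightD(1)[OF W] by (intro sum_pos) auto
  have K: "0 < K" by (rule A1_weight_pos[OF W])
  have "(\<Sum>i=m..n. g i) * S = (\<Sum>i=m..n. g i * S)" by (simp add: sum_distrib_right)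
  also have "\<dots> \<le> (\<Sum>i=m..n. g i * (K * real_of_int (n - m + 1) * W i))"
    unfolding S_def by (intro sum_mono mult_left_mono g A1_weightD(2)[OF W]) auto
  also have "\<dots> = K * real_of_int (n - m + 1) * (\<Sum>i=m..n. g i * W i)"
    by (simp add: sum_distrib_left mult_ac)
  also have "\<dots> \<le> K * real_of_int (n - m + 1) * (z * S)"
    using avg K mn unfolding S_def by (intro mult_left_mono) auto
  finally have "(\<Sum>i=m..n. g i) * S \<le> (K * z * real_of_int (n - m + 1)) * S" by (simp add: mult_ac)
  then show ?thesis using S by (simp del: of_int_diff of_int_add)
qed

text \<open>With \<open>f = H a\<close>, write \<open>|f|\<^sup>r W = |f| g\<close> where \<open>g = |f|\<^bsup>r-1\<^esup> W\<close>, and use \<open>sharp_duality\<close> on a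
  large interval. Let \<open>N\<close> and \<open>V\<close> be the maximal functions with respect to \<open>W\<close> of \<open>|a|\<^sup>q\<close> and of
  \<open>|f|\<^bsup>r-1\<^esup>\<close>. The \<open>A\<^sub>1\<close> condition bounds the oscillations of \<open>f\<close> by multiples of \<open>N\<^bsup>1/q\<^esup>\<close> and the averages of \<open>g\<close>
  by multiples of \<open>V W\<close>. Then \<open>\<Sum> N\<^bsup>1/q\<^esup> V W\<close> is estimated by Hoelder's inequality with exponents
  \<open>r\<close> and \<open>s = r/(r-1)\<close>, together with the boundedness of the two maximal functions on \<open>L\<^bsup>r/q\<^esup>\<close> and \<open>L\<^sup>s\<close>.\<close>

lemma partial_hilbert_weighted:
  assumes q: "1 < q" "q < r" and C: "lp_bound q C"
  shows "\<exists>D\<ge>0. \<forall>W A E a. A1_weight K W \<longrightarrow> finite A \<longrightarrow> finite E \<longrightarrow>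
     (\<Sum>j\<in>E. cmod (partial_hilbert A a j) powr r * W j) \<le> D * (\<Sum>i\<in>A. cmod (a i) powr r * W i)"
proof -
  have C0: "0 \<le> C" using C by (simp add: lp_bound_def)
  define t where "t = r / q"
  define s where "s = r / (r - 1)"
  have t: "t > 1" using q by (simp add: t_def)
  have s: "s > 1" "1 / r + 1 / s = 1" "1 / s = 1 - 1 / r" "(r - 1) * s = r"
    using q by (auto simp: s_def field_simps)
  define D where "D = 2 * ((3 * C) powr (1/q) + 16)"
  define K1 where "K1 = 2 powr t * 2 * (t / (t - 1)) powr t"
  define K2 where "K2 = 2 powr s * 2 * (s / (s - 1)) powr s"
  define c where "c = 8 * D * K powr (1/q) * K * K1 powr (1/r) * K2 powr (1/s)"
  have D: "0 \<le> D" using C0 by (simp add: D_def)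
  have "(\<Sum>j\<in>E. cmod (partial_hilbert A a j) powr r * W j) \<le> c powr r * (\<Sum>i\<in>A. cmod (a i) powr r * W i)"
    if W: "A1_weight K W" and A: "finite A" and E: "finite E" for W A E a
  proof -
    note Wpos = A1_weightD(1)[OF W]
    have Wnn: "0 \<le> W i" for i using Wpos[of i] by simp
    have K: "0 < K" by (rule A1_weight_pos[OF W])
    define f where "f = partial_hilbert A a"
    define X where "X = (\<Sum>i\<in>A. cmod (a i) powr r * W i)"
    define Y where "Y = (\<Sum>j\<in>E. cmod (f j) powr r * W j)"
    have X0: "0 \<le> X" and Y0: "0 \<le> Y"
      unfolding X_def Y_def by (auto intro!: sum_nonneg mult_nonneg_nonneg simp: Wnn)
    define g1 where "g1 i = (if i \<in> A then cmod (a i) powr q else 0)" for i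
    obtain N where N: "\<And>x. 0 \<le> N x"
      "\<And>m n x. m \<le> x \<Longrightarrow> x \<le> n \<Longrightarrow> (\<Sum>i=m..n. g1 i * W i) \<le> N x * (\<Sum>i=m..n. W i)"
      "\<And>E. finite E \<Longrightarrow> (\<Sum>x\<in>E. N x powr t * W x) \<le> K1 * (\<Sum>x\<in>A. g1 x powr t * W x)"
      unfolding K1_def
      by (rule weighted_maximal_bound[of W g1 A t]) (use Wpos A t in \<open>auto simp: g1_def\<close>)
    define g2 where "g2 i = (if i \<in> E then cmod (f i) powr (r - 1) else 0)" for i
    obtain V where V: "\<And>x. 0 \<le> V x"
      "\<And>m n x. m \<le> x \<Longrightarrow> x \<le> n \<Longrightarrow> (\<Sum>i=m..n. g2 i * W i) \<le> V x * (\<Sum>i=m..n. W i)"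
      "\<And>E'. finite E' \<Longrightarrow> (\<Sum>x\<in>E'. V x powr s * W x) \<le> K2 * (\<Sum>x\<in>E. g2 x powr s * W x)"
      unfolding K2_def
      by (rule weighted_maximal_bound[of W g2 E s]) (use Wpos E s in \<open>auto simp: g2_def\<close>)
    have NX: "(\<Sum>x\<in>E'. N x powr t * W x) \<le> K1 * X" if "finite E'" for E'
    proof -
      have "(\<Sum>x\<in>A. g1 x powr t * W x) = X"
        using q by (auto simp: X_def g1_def powr_powr t_def intro!: sum.cong)
      then show ?thesis using N(3)[OF that] by simp
    qed
    have VY: "(\<Sum>x\<in>E'. V x powr s * W x) \<le> K2 * Y" if "finite E'" for E'
    proof -
      have "(\<Sum>x\<in>E. g2 x powr s * W x) = Y"
        using q by (auto simp: Y_def g2_def powr_powr s(4) intro!: sum.cong)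
      then show ?thesis using V(3)[OF that] by simp
    qed
    define F where "F x = D * (K * N x) powr (1/q)" for x
    define G where "G x = K * V x * W x" for x
    define g where "g i = g2 i * W i" for i
    have g0: "0 \<le> g i" for i by (simp add: g_def g2_def Wnn)
    have as_atLeastAtMost: "pow2_interval k m = {k..k + 2 ^ m - 1}" for k m by (auto simp: pow2_interval_def)
    define B where "B = c * X powr (1/r) * Y powr (1 - 1/r)"
    have sharp: "(\<Sum>i\<in>pow2_interval l n. cmod (f i - mean (pow2_interval l n) f) * g i) \<le> B" for l n
    proof -
      have e1: "(\<Sum>i\<in>pow2_interval l n. cmod (f i - mean (pow2_interval l n) f) * g i) \<le> 8 * (\<Sum>i\<in>pow2_interval l n. F i * G i)"
      proof (rule sharp_duality)
        show "0 \<le> F i" "0 \<le> G i" for i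
          using D K V(1)[of i] Wnn[of i] by (auto simp: F_def G_def)
        fix k m x assume x: "x \<in> pow2_interval k m"
        have "(\<Sum>i\<in>pow2_interval k m. cmod (f i - mean (pow2_interval k m) f))
            \<le> 2 * ((3 * C) powr (1/q) + 16) * (K * N x) powr (1/q) * 2 ^ m"
          unfolding f_def
        proof (rule partial_hilbert_oscillation[OF _ C A x])
          fix u v assume uv: "u \<le> x" "x < v"
          have "(\<Sum>i\<in>A \<inter> {u..<v}. cmod (a i) powr q) = (\<Sum>i=u..v-1. g1 i)"
            using uv by (intro sum.mono_neutral_cong_left) (auto simp: g1_def)
          also have "\<dots> \<le> K * N x * real_of_int ((v - 1) - u + 1)"
            by (rule A1_average_le[OF W _ _ N(2)]) (use uv in \<open>auto simp: g1_def\<close>)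
          also have "K * N x = ((K * N x) powr (1/q)) powr q"
            using q K N(1)[of x] by (simp add: powr_powr powr_one)
          finally show "(\<Sum>i\<in>A \<inter> {u..<v}. cmod (a i) powr q) \<le> ((K * N x) powr (1/q)) powr q * real_of_int (v - u)"
            by simp
        qed (use q in auto)
        then show "(\<Sum>i\<in>pow2_interval k m. cmod (f i - mean (pow2_interval k m) f)) \<le> F x * 2 ^ m"
          by (simp add: F_def D_def)
        have x': "k \<le> x" "x \<le> k + 2 ^ m - 1" using x by (auto simp: pow2_interval_def)
        have "sum g (pow2_interval k m) \<le> V x * (\<Sum>i=k..k + 2 ^ m - 1. W i)"
          unfolding g_def as_atLeastAtMost by (rule V(2)[OF x'])
        also have "\<dots> \<le> V x * (K * real_of_int (k + 2 ^ m - 1 - k + 1) * W x)"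
          by (intro mult_left_mono V(1) A1_weightD(2)[OF W] x')
        finally show "sum g (pow2_interval k m) \<le> G x * 2 ^ m" by (simp add: G_def mult_ac)
      qed (rule g0)
      have e2: "(\<Sum>i\<in>pow2_interval l n. F i * G i) = D * K powr (1/q) * K * (\<Sum>i\<in>pow2_interval l n. N i powr (1/q) * V i * W i)"
        using K N(1) by (simp add: F_def G_def powr_mult sum_distrib_left mult_ac)
      have "(\<Sum>i\<in>pow2_interval l n. N i powr (1/q) * V i * W i)
          \<le> (\<Sum>i\<in>pow2_interval l n. (N i powr (1/q)) powr r * W i) powr (1/r) * (\<Sum>i\<in>pow2_interval l n. V i powr s * W i) powr (1/s)"
        using q s(1,2) V(1) Wnn by (intro Holder_sum) auto
      also have "\<dots> = (\<Sum>i\<in>pow2_interval l n. N i powr t * W i) powr (1/r) * (\<Sum>i\<in>pow2_interval l n. V i powr s * W i) powr (1/s)"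
        by (simp add: powr_powr t_def)
      also have "\<dots> \<le> (K1 * X) powr (1/r) * (K2 * Y) powr (1/s)"
        using q s(1) by (intro mult_mono powr_mono2 NX[OF finite_pow2_interval] VY[OF finite_pow2_interval])
          (auto intro!: sum_nonneg mult_nonneg_nonneg simp: Wnn)
      finally have e3: "(\<Sum>i\<in>pow2_interval l n. N i powr (1/q) * V i * W i) \<le> (K1 * X) powr (1/r) * (K2 * Y) powr (1/s)" .
      note e1
      also have "8 * (\<Sum>i\<in>pow2_interval l n. F i * G i)
          \<le> 8 * (D * K powr (1/q) * K * ((K1 * X) powr (1/r) * (K2 * Y) powr (1/s)))"
        unfolding e2 using D K by (intro mult_left_mono e3) auto
      also have "\<dots> = B"
        using X0 Y0 t s by (simp add: B_def c_def powr_mult K1_def K2_def mult_ac)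
      finally show ?thesis .
    qed
    have "\<exists>L. \<forall>y \<in> E. L \<le> y"
      using E by (intro bdd_below.unfold[THEN iffD1] bdd_below_finite) auto
    then obtain l where l: "\<And>y. y \<in> E \<Longrightarrow> l \<le> y" by auto
    have "\<exists>U. \<forall>y \<in> E. y \<le> U"
      using E by (intro bdd_above.unfold[THEN iffD1] bdd_above_finite) auto
    then obtain U where U: "\<And>y. y \<in> E \<Longrightarrow> y \<le> U" by auto
    \<comment> \<open>Once the interval contains \<open>E\<close>, only the mean of \<open>f\<close> separates \<open>sharp\<close> from a bound for \<open>Y\<close>.\<close>
    have "Y \<le> B + cmod (mean (pow2_interval l n) f) * sum g E" if n: "nat (U - l) \<le> n" for n
    proof -
      have "int n < 2 ^ n" using of_nat_less_two_power[of n] by simp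
      have sub: "E \<subseteq> pow2_interval l n"
      proof
        fix y assume y: "y \<in> E"
        have "y < l + 2 ^ n" using U[OF y] n \<open>int n < 2 ^ n\<close> by linarith
        then show "y \<in> pow2_interval l n" using l[OF y] by (simp add: pow2_interval_def)
      qed
      have out: "g i = 0" if "i \<notin> E" for i using that by (simp add: g_def g2_def)
      have "cmod (f i) powr r = cmod (f i) * cmod (f i) powr (r - 1)" for i
        using powr_add[of "cmod (f i)" 1 "r - 1"] by (simp add: powr_one)
      then have "Y = (\<Sum>i\<in>E. cmod (f i) * g i)"
        by (simp add: Y_def g_def g2_def mult_ac)
      also have "\<dots> \<le> (\<Sum>i\<in>E. cmod (f i - mean (pow2_interval l n) f) * g i + cmod (mean (pow2_interval l n) f) * g i)"
      proof (rule sum_mono)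
        fix i
        have "cmod (f i) \<le> cmod (f i - mean (pow2_interval l n) f) + cmod (mean (pow2_interval l n) f)"
          using norm_triangle_ineq[of "f i - mean (pow2_interval l n) f" "mean (pow2_interval l n) f"] by simp
        then have "cmod (f i) * g i \<le> (cmod (f i - mean (pow2_interval l n) f) + cmod (mean (pow2_interval l n) f)) * g i"
          by (intro mult_right_mono g0)
        then show "cmod (f i) * g i \<le> cmod (f i - mean (pow2_interval l n) f) * g i + cmod (mean (pow2_interval l n) f) * g i"
          by (simp add: distrib_right)
      qed
      also have "\<dots> = (\<Sum>i\<in>pow2_interval l n. cmod (f i - mean (pow2_interval l n) f) * g i) + cmod (mean (pow2_interval l n) f) * sum g E"
        using sub out by (subst sum.mono_neutral_right[of "pow2_interval l n" E])
          (auto simp: sum.distrib sum_distrib_left)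
      also have "\<dots> \<le> B + cmod (mean (pow2_interval l n) f) * sum g E" using sharp[of l n] by simp
      finally show ?thesis .
    qed
    moreover have "(\<lambda>n. B + cmod (mean (pow2_interval l n) f) * sum g E) \<longlonglongrightarrow> B + 0 * sum g E"
      unfolding f_def by (intro tendsto_intros tendsto_mean_partial_hilbert A)
    ultimately have "Y \<le> B"
      by (intro tendsto_lowerbound[of _ B sequentially Y])
         (auto simp: eventually_sequentially)
    then have "Y \<le> c powr r * X"
      unfolding B_def using q D K by (intro absorb_powr X0 Y0) (auto simp: c_def K1_def K2_def)
    then show ?thesis by (simp add: X_def Y_def f_def)
  qed
  then show ?thesis by (intro exI[of _ "c powr r"]) auto
qed

lemma lp_bound_2: "lp_bound 2 12"
  using partial_hilbert_l2 by (simp add: lp_bound_def)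

lemma lp_bound_above_2:
  assumes "2 < q"
  shows "\<exists>C. lp_bound q C"
proof -
  have W: "A1_weight 1 (\<lambda>_. 1)" by (auto simp: A1_weight_def)
  obtain D where "D \<ge> 0" "\<forall>W A E a. A1_weight 1 W \<longrightarrow> finite A \<longrightarrow> finite E \<longrightarrow>
     (\<Sum>j\<in>E. cmod (partial_hilbert A a j) powr q * W j) \<le> D * (\<Sum>i\<in>A. cmod (a i) powr q * W i)"
    using partial_hilbert_weighted[OF _ assms lp_bound_2, of 1] by auto
  then have "lp_bound q D" unfolding lp_bound_def using W by fastforce
  then show ?thesis by blast
qed

text \<open>\<open>H\<close> is antisymmetric, so pairing \<open>H a\<close> with \<open>b = |H a|\<^bsup>q-2\<^esup> cnj (H a)\<close> gives
  \<open>\<Sum> |H a|\<^sup>q = - \<Sum> a H b\<close>, and the norm of \<open>b\<close> in the dual space is a power of the left-hand side.\<close>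

lemma lp_bound_dual:
  assumes q: "1 < q" and s: "s = q / (q - 1)" and C: "lp_bound s C"
  shows "lp_bound q ((C powr (1/s)) powr q)"
proof -
  have C0: "0 \<le> C" using C by (simp add: lp_bound_def)
  have s': "s > 1" "1 / q + 1 / s = 1" "1 / s = 1 - 1 / q" "(q - 1) * s = q"
    using q by (auto simp: s field_simps)
  have "(\<Sum>j\<in>E. cmod (partial_hilbert A a j) powr q) \<le> (C powr (1/s)) powr q * (\<Sum>i\<in>A. cmod (a i) powr q)"
    if A: "finite A" and E: "finite E" for A E a
  proof -
    define f where "f = partial_hilbert A a"
    define b where "b j = of_real (cmod (f j) powr (q - 2)) * cnj (f j)" for j
    define X where "X = (\<Sum>i\<in>A. cmod (a i) powr q)"
    define Y where "Y = (\<Sum>j\<in>E. cmod (f j) powr q)"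
    have fb: "f j * b j = of_real (cmod (f j) powr q)" for j
    proof (cases "f j = 0")
      case False
      have "f j * b j = of_real (cmod (f j) powr (q - 2) * (cmod (f j))\<^sup>2)"
        by (simp only: b_def of_real_mult complex_norm_square mult_ac)
      also have "cmod (f j) powr (q - 2) * (cmod (f j))\<^sup>2 = cmod (f j) powr q"
        using False powr_add[of "cmod (f j)" "q - 2" 2] by simp
      finally show ?thesis .
    qed (use q in \<open>simp add: b_def\<close>)
    have bs: "cmod (b j) powr s = cmod (f j) powr q" for j
    proof (cases "f j = 0")
      case False
      have "cmod (b j) = cmod (f j) powr (q - 1)"
        using False powr_add[of "cmod (f j)" "q - 2" 1] by (simp add: b_def norm_mult powr_one)
      then show ?thesis by (simp add: powr_powr s')
    qed (use q in \<open>simp add: b_def\<close>)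
    have "complex_of_real Y = (\<Sum>j\<in>E. \<Sum>i\<in>A. a i / of_int (i - j) * b j)"
      unfolding Y_def of_real_sum fb[symmetric] by (simp add: f_def partial_hilbert_def sum_distrib_right)
    also have "\<dots> = (\<Sum>i\<in>A. \<Sum>j\<in>E. a i / of_int (i - j) * b j)" by (rule sum.swap)
    also have "\<dots> = (\<Sum>i\<in>A. - (a i * partial_hilbert E b i))"
    proof (intro sum.cong refl)
      fix i
      have "a i / of_int (i - j) * b j = - (a i * (b j / of_int (j - i)))" for j
      proof -
        have "of_int (i - j) = - (of_int (j - i) :: complex)" by simp
        then show ?thesis by (simp only: divide_minus_right mult_minus_left times_divide_eq_left times_divide_eq_right)
      qed
      then show "(\<Sum>j\<in>E. a i / of_int (i - j) * b j) = - (a i * partial_hilbert E b i)"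
        by (simp only: partial_hilbert_def sum_distrib_left sum_negf)
    qed
    finally have "Y = cmod (\<Sum>i\<in>A. - (a i * partial_hilbert E b i))"
      using norm_of_real[of Y, where 'a = complex] by (simp add: Y_def sum_nonneg)
    also have "\<dots> \<le> (\<Sum>i\<in>A. cmod (a i) * cmod (partial_hilbert E b i) * 1)"
      by (rule order_trans[OF norm_sum]) (simp add: norm_mult)
    also have "\<dots> \<le> (\<Sum>i\<in>A. cmod (a i) powr q * 1) powr (1/q)
        * (\<Sum>i\<in>A. cmod (partial_hilbert E b i) powr s * 1) powr (1/s)"
      using q s' A by (intro Holder_sum) auto
    also have "\<dots> \<le> X powr (1/q) * (C * Y) powr (1/s)"
    proof -
      have "(\<Sum>i\<in>A. cmod (partial_hilbert E b i) powr s) \<le> C * (\<Sum>j\<in>E. cmod (b j) powr s)"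
        by (rule lp_boundD[OF C E A])
      then show ?thesis
        using s' q by (intro mult_mono powr_mono2) (auto simp: X_def Y_def bs sum_nonneg)
    qed
    also have "\<dots> = C powr (1/s) * X powr (1/q) * Y powr (1 - 1/q)"
      using C0 by (simp add: powr_mult s'(3) Y_def sum_nonneg)
    finally have "Y \<le> (C powr (1/s)) powr q * X"
      by (intro absorb_powr) (use q in \<open>auto simp: X_def Y_def sum_nonneg\<close>)
    then show ?thesis by (simp add: X_def Y_def f_def)
  qed
  then show ?thesis by (auto simp: lp_bound_def)
qed

lemma lp_bound_all:
  assumes q: "1 < q"
  shows "\<exists>C. lp_bound q C"
proof -
  consider "q > 2" | "q = 2" | "q < 2" by linarith
  then show ?thesis
  proof cases
    case 3
    then have "2 < q / (q - 1)" using q by (simp add: field_simps)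
    then obtain C where "lp_bound (q / (q - 1)) C" using lp_bound_above_2 by blast
    then show ?thesis using lp_bound_dual[OF q refl] by blast
  qed (use lp_bound_2 lp_bound_above_2 in auto)
qed

lemma partial_hilbert_A1:
  assumes r: "1 < r"
  shows "\<exists>D\<ge>0. \<forall>W A E a. A1_weight K W \<longrightarrow> finite A \<longrightarrow> finite E \<longrightarrow>
     (\<Sum>j\<in>E. cmod (partial_hilbert A a j) powr r * W j) \<le> D * (\<Sum>i\<in>A. cmod (a i) powr r * W i)"
proof -
  \<comment> \<open>Any exponent strictly between \<open>1\<close> and \<open>r\<close> would do.\<close>
  obtain C where "lp_bound ((1 + r) / 2) C" using lp_bound_all[of "(1 + r) / 2"] r by auto
  then show ?thesis using r by (intro partial_hilbert_weighted[of "(1 + r) / 2"]) auto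
qed

section \<open>Variable exponents and the algorithm of Rubio de Francia\<close>

text \<open>The modular of \<open>u\<close> is at most \<open>1\<close>, for nonnegative \<open>u\<close>, stated through finite sums so that
  no summability has to be discussed.\<close>

definition unit_modular :: "(int \<Rightarrow> real) \<Rightarrow> (int \<Rightarrow> real) \<Rightarrow> bool" where
  "unit_modular p u \<longleftrightarrow> (\<forall>F. finite F \<longrightarrow> (\<Sum>i\<in>F. u i powr p i) \<le> 1)"

lemma unit_modularD: "unit_modular p u \<Longrightarrow> finite F \<Longrightarrow> (\<Sum>i\<in>F. u i powr p i) \<le> 1"
  by (simp add: unit_modular_def)

lemma unit_modular_mono:
  assumes "unit_modular p v" "\<And>i. 0 \<le> u i" "\<And>i. u i \<le> v i" "\<And>i. 0 \<le> p i"
  shows "unit_modular p u"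
  unfolding unit_modular_def
proof (intro allI impI)
  fix F :: "int set" assume F: "finite F"
  have "(\<Sum>i\<in>F. u i powr p i) \<le> (\<Sum>i\<in>F. v i powr p i)"
    using assms by (intro sum_mono powr_mono2) auto
  also have "\<dots> \<le> 1" by (rule unit_modularD[OF assms(1) F])
  finally show "(\<Sum>i\<in>F. u i powr p i) \<le> 1" .
qed

lemma infsum_modular_le_1_iff:
  assumes "l > 0"
  shows "(\<Sum>\<^sub>\<infinity>i\<in>UNIV. ennreal (cmod (a i / of_real l) powr p i)) \<le> 1
    \<longleftrightarrow> unit_modular p (\<lambda>i. cmod (a i) / l)"
  using assms
  by (subst nonneg_infsum_complete) (auto simp: SUP_le_iff unit_modular_def norm_divide)

lemma lp_norm_le:
  assumes "l > 0" "unit_modular p (\<lambda>i. cmod (a i) / l)"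
  shows "lp_norm p a \<le> ennreal l"
  unfolding lp_norm_def using assms infsum_modular_le_1_iff[OF assms(1), of a p]
  by (intro INF_lower) auto

lemma unit_modular_of_lp_norm_less:
  assumes "\<And>i. 0 \<le> p i" "lp_norm p a < ennreal l"
  shows "unit_modular p (\<lambda>i. cmod (a i) / l)"
proof -
  obtain k where k: "k > 0" "(\<Sum>\<^sub>\<infinity>i\<in>UNIV. ennreal (cmod (a i / of_real k) powr p i)) \<le> 1" "ennreal k < ennreal l"
    using assms(2) unfolding lp_norm_def INF_less_iff by auto
  then have "unit_modular p (\<lambda>i. cmod (a i) / k)" by (simp add: infsum_modular_le_1_iff)
  moreover have "k < l" using k by (simp add: ennreal_less_iff)
  ultimately show ?thesis using k(1) assms(1)
    by (elim unit_modular_mono) (auto intro!: divide_left_mono)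
qed

lemma sum_cmod_le_maximal:
  assumes "bdd_above (averages a x)" "m \<le> x" "x \<le> n"
  shows "(\<Sum>i=m..n. cmod (a i)) \<le> real_of_int (n - m + 1) * maximal a x"
proof -
  have "(\<Sum>i=m..n. cmod (a i)) / real_of_int (n - m + 1) \<le> maximal a x"
    unfolding maximal_def using assms by (intro cSup_upper) (auto simp: averages_def)
  then show ?thesis using assms by (simp add: divide_le_eq mult.commute)
qed

text \<open>As \<open>h\<close> has norm at most \<open>1\<close>, \<open>M\<^sup>k h\<close> has norm at most \<open>K\<^sup>k\<close>, and the terms of \<open>W = \<Sum>\<^sub>k M\<^sup>k h / (2 K)\<^sup>k\<close> decay geometrically.
  By sublinearity, \<open>M W\<close> is at most the series with \<open>M\<close> applied to each term, which is \<open>2 K\<close> times the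
  series without its first term. So \<open>W\<close> is an \<open>A\<^sub>1\<close> weight whose constant does not depend on \<open>h\<close>. The
  condition that \<open>h\<close> does not vanish makes \<open>W\<close> positive.\<close>

lemma Rubio_de_Francia:
  assumes s: "s \<in> class_B"
  shows "\<exists>K. \<forall>h. (\<forall>i. 0 \<le> h i) \<longrightarrow> (\<exists>i. 0 < h i) \<longrightarrow> unit_modular s h \<longrightarrow>
    (\<exists>W. A1_weight K W \<and> (\<forall>i. h i \<le> W i) \<and> unit_modular s (\<lambda>i. W i / 4))"
proof -
  have s1: "1 \<le> s i" for i using s by (auto simp: class_B_def class_P_def)
  obtain K :: real where K: "K > 0"
    "\<And>a. a \<in> lp_space s \<Longrightarrow> lp_norm s (\<lambda>j. of_real (maximal a j)) \<le> ennreal K * lp_norm s a"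
    using s by (auto simp: class_B_def)
  have "\<exists>W. A1_weight (2 * K) W \<and> (\<forall>i. h i \<le> W i) \<and> unit_modular s (\<lambda>i. W i / 4)"
    if h: "\<And>i. 0 \<le> h i" "0 < h i0" "unit_modular s h" for h i0
  proof -
    define u where "u k = ((\<lambda>v j. maximal (\<lambda>i. complex_of_real (v i)) j) ^^ k) h" for k
    have u0: "u 0 = h" by (simp add: u_def)
    have uSuc: "u (Suc k) = (\<lambda>j. maximal (\<lambda>i. complex_of_real (u k i)) j)" for k by (simp add: u_def)
    have norm_u: "lp_norm s (\<lambda>i. of_real (u k i)) \<le> ennreal (K ^ k)" for k
    proof (induction k)
      case 0
      then show ?case using h by (intro lp_norm_le) (auto simp: u0)
    next
      case (Suc k)
      have "lp_norm s (\<lambda>i. of_real (u k i)) < \<infinity>" using Suc by (simp add: le_less_trans)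
      then have "lp_norm s (\<lambda>i. of_real (u (Suc k) i)) \<le> ennreal K * lp_norm s (\<lambda>i. of_real (u k i))"
        unfolding uSuc by (intro K(2)) (simp add: lp_space_def)
      also have "\<dots> \<le> ennreal K * ennreal (K ^ k)" by (intro mult_left_mono Suc) auto
      also have "\<dots> = ennreal (K ^ Suc k)" using K(1) by (simp add: ennreal_mult)
      finally show ?case .
    qed
    have bdd: "bdd_above (averages (\<lambda>i. of_real (u k i)) x)" for k x
    proof (rule bdd_above_averages[OF s1])
      show "(\<lambda>i. complex_of_real (u k i)) \<in> lp_space s"
        using norm_u[of k] by (simp add: lp_space_def le_less_trans)
    qed
    have step: "(\<Sum>i=m..n. \<bar>u k i\<bar>) \<le> real_of_int (n - m + 1) * u (Suc k) x" if "m \<le> x" "x \<le> n" for k m n x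
      using sum_cmod_le_maximal[OF bdd[of k x] that] by (simp add: uSuc)
    have unn: "0 \<le> u k x" for k x
    proof (cases k)
      case (Suc j)
      then show ?thesis using step[of x x x j] by simp
    qed (simp add: u0 h)
    \<comment> \<open>The norm is an infimum that need not be attained; the factor \<open>2\<close> makes the inequality strict.\<close>
    have mod_u: "unit_modular s (\<lambda>i. u k i / (2 * K ^ k))" for k
    proof -
      have "ennreal (K ^ k) < ennreal (2 * K ^ k)" using K(1) by (simp add: ennreal_less_iff)
      then have "lp_norm s (\<lambda>i. of_real (u k i)) < ennreal (2 * K ^ k)"
        using norm_u[of k] by (rule le_less_trans[rotated])
      then show ?thesis
        using unit_modular_of_lp_norm_less[of s "\<lambda>i. of_real (u k i)"] s1 unn
        by (force intro: order_trans[OF zero_le_one])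
    qed
    have u_le: "u k i \<le> 2 * K ^ k" for k i
    proof -
      have "cmod (complex_of_real (u k i)) / (2 * K ^ k) \<le> 1"
        using K(1) unn unit_modularD[OF mod_u[of k]] by (intro lp_space_bounded[OF s1]) auto
      then show ?thesis using K(1) unn[of k i] by (simp add: divide_le_eq)
    qed
    define w where "w k i = u k i / (2 * K) ^ k" for k i
    have wnn: "0 \<le> w k i" for k i using unn K(1) by (simp add: w_def)
    \<comment> \<open>Hence \<open>W/4\<close> is a combination of sequences of modular at most \<open>1\<close> with coefficients \<open>2\<^bsup>-k-1\<^esup>\<close>.\<close>
    have wv: "w k i = 2 * (1/2) ^ k * (u k i / (2 * K ^ k))" for k i
      by (simp add: w_def power_mult_distrib power_divide)
    have summ: "summable (\<lambda>k. w k i)" for i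
    proof (rule summable_comparison_test[of _ "\<lambda>k. 2 * (1/2) ^ k"])
      show "\<exists>N. \<forall>k\<ge>N. norm (w k i) \<le> 2 * (1/2) ^ k"
      proof (intro exI allI impI)
        fix k
        have "w k i \<le> 2 * (1/2) ^ k * 1"
          unfolding wv using u_le[of k i] K(1) by (intro mult_left_mono) (auto simp: divide_le_eq)
        then show "norm (w k i) \<le> 2 * (1/2) ^ k" using wnn[of k i] by simp
      qed
    qed (intro summable_mult summable_geometric, simp)
    have summ_Suc: "summable (\<lambda>k. w (Suc k) i)" for i
      using summ[of i] by (simp add: summable_Suc_iff[of "\<lambda>k. w k i"])
    define W where "W i = (\<Sum>k. w k i)" for i
    have hW: "h i \<le> W i" for i
      using sum_le_suminf[OF summ, of "{0}" i] wnn by (simp add: W_def w_def u0)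
    have W0: "0 \<le> W i" for i using hW[of i] h(1)[of i] by simp
    have A1: "(\<Sum>i=m..n. W i) \<le> 2 * K * real_of_int (n - m + 1) * W x" if mx: "m \<le> x" "x \<le> n" for m n x
    proof -
      have "(\<Sum>i=m..n. W i) = (\<Sum>k. \<Sum>i=m..n. w k i)"
        unfolding W_def using summ by (simp add: suminf_sum)
      also have "\<dots> \<le> (\<Sum>k. 2 * K * real_of_int (n - m + 1) * w (Suc k) x)"
      proof (rule suminf_le)
        fix k
        have "(\<Sum>i=m..n. w k i) = (\<Sum>i=m..n. \<bar>u k i\<bar>) / (2 * K) ^ k"
          using unn by (simp add: w_def sum_divide_distrib)
        also have "\<dots> \<le> real_of_int (n - m + 1) * u (Suc k) x / (2 * K) ^ k"
          using K(1) by (intro divide_right_mono step mx) auto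
        also have "\<dots> = 2 * K * real_of_int (n - m + 1) * w (Suc k) x"
          using K(1) by (simp add: w_def)
        finally show "(\<Sum>i=m..n. w k i) \<le> 2 * K * real_of_int (n - m + 1) * w (Suc k) x" .
      qed (intro summable_sum summable_mult summ summ_Suc)+
      also have "\<dots> = 2 * K * real_of_int (n - m + 1) * (\<Sum>k. w (Suc k) x)"
        by (rule suminf_mult[OF summ_Suc])
      also have "\<dots> \<le> 2 * K * real_of_int (n - m + 1) * W x"
        using suminf_split_head[OF summ[of x]] wnn[of 0 x] K(1) mx
        by (intro mult_left_mono) (auto simp: W_def)
      finally show ?thesis .
    qed
    have Wpos: "0 < W x" for x
    proof -
      have "0 < W i0" using h(2) hW[of i0] by simp
      also have "W i0 \<le> (\<Sum>i=min x i0..max x i0. W i)"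
        using W0 by (intro member_le_sum) auto
      also have "\<dots> \<le> 2 * K * real_of_int (max x i0 - min x i0 + 1) * W x" by (rule A1) auto
      finally show ?thesis using W0[of x] by (cases "W x = 0") auto
    qed
    have "unit_modular s (\<lambda>i. W i / 4)"
      unfolding unit_modular_def
    proof (intro allI impI)
      fix F :: "int set" assume F: "finite F"
      define v where "v k i = u k i / (2 * K ^ k)" for k i
      define c where "c k = (1/2::real) ^ Suc k" for k
      have c: "(\<Sum>k<n. c k) \<le> 1" for n
      proof -
        have "(\<Sum>k<n. c k) = 1 - (1/2) ^ n" by (induction n) (auto simp: c_def)
        then show ?thesis by simp
      qed
      have part: "(\<Sum>i\<in>F. ((\<Sum>k<n. w k i) / 4) powr s i) \<le> 1" for n
      proof -
        have eq: "(\<Sum>k<n. w k i) / 4 = (\<Sum>k<n. c k * v k i)" for i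
          by (simp add: wv c_def v_def sum_divide_distrib mult.commute)
        have "(\<Sum>i\<in>F. ((\<Sum>k<n. w k i) / 4) powr s i) \<le> (\<Sum>i\<in>F. \<Sum>k<n. c k * v k i powr s i)"
          unfolding eq
          by (intro sum_mono Jensen_powr_sum) (use s1 c[of n] K(1) unn in \<open>auto simp: v_def c_def\<close>)
        also have "\<dots> = (\<Sum>k<n. c k * (\<Sum>i\<in>F. v k i powr s i))"
          by (subst sum.swap) (simp add: sum_distrib_left)
        also have "\<dots> \<le> (\<Sum>k<n. c k * 1)"
          unfolding v_def by (intro sum_mono mult_left_mono unit_modularD[OF mod_u F]) (auto simp: c_def)
        finally show ?thesis using c[of n] by simp
      qed
      have "(\<lambda>n. \<Sum>i\<in>F. ((\<Sum>k<n. w k i) / 4) powr s i) \<longlonglongrightarrow> (\<Sum>i\<in>F. (W i / 4) powr s i)"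
      proof (intro tendsto_sum tendsto_powr tendsto_const)
        show "(\<lambda>n. (\<Sum>k<n. w k i) / 4) \<longlonglongrightarrow> W i / 4" for i
          unfolding W_def by (intro tendsto_divide summable_LIMSEQ summ tendsto_const) simp
        show "W i / 4 \<noteq> 0" for i using Wpos[of i] by simp
      qed
      then show "(\<Sum>i\<in>F. (W i / 4) powr s i) \<le> 1"
        by (rule LIMSEQ_le_const2) (use part in auto)
    qed
    then show ?thesis using A1 Wpos hW by (intro exI[of _ W]) (auto simp: A1_weight_def)
  qed
  then show ?thesis by (intro exI[of _ "2 * K"]) blast
qed

text \<open>Suppose the modular \<open>S\<close> of \<open>f = |H a|/C\<close> exceeds \<open>1\<close>. The function \<open>h = f\<^bsup>p-r\<^esup>/S\<close> is dual
  to \<open>f\<^sup>r\<close>: its modular for the exponent \<open>s\<close> conjugate to \<open>p/r\<close> is at most \<open>1\<close>, and \<open>\<Sum> f\<^sup>r h = 1\<close>.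
  Replacing \<open>h\<close> by its \<open>A\<^sub>1\<close> majorant \<open>W\<close> and applying the weighted inequality bounds this by
  \<open>D/C\<^sup>r \<Sum> |a|\<^sup>r W\<close>, which by Young's inequality is at most \<open>8 D/C\<^sup>r\<close>. This is less than \<open>1\<close> for the
  chosen \<open>C\<close>, a contradiction.\<close>

lemma extrapolation:
  fixes p s :: "int \<Rightarrow> real"
  assumes r: "1 < r" and p: "\<And>i. r < p i" and s: "\<And>i. s i = p i / (p i - r)" and B: "s \<in> class_B"
  shows "\<exists>C>0. \<forall>A a E. finite A \<longrightarrow> finite E \<longrightarrow> (\<Sum>i\<in>A. cmod (a i) powr p i) \<le> 1 \<longrightarrow>
    (\<Sum>j\<in>E. (cmod (partial_hilbert A a j) / C) powr p j) \<le> 1"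
proof -
  obtain K where K: "\<And>h. (\<forall>i. 0 \<le> h i) \<Longrightarrow> (\<exists>i. 0 < h i) \<Longrightarrow> unit_modular s h \<Longrightarrow>
    (\<exists>W. A1_weight K W \<and> (\<forall>i. h i \<le> W i) \<and> unit_modular s (\<lambda>i. W i / 4))"
    using Rubio_de_Francia[OF B] by metis
  obtain D where D: "D \<ge> 0" "\<And>W A E a. A1_weight K W \<Longrightarrow> finite A \<Longrightarrow> finite E \<Longrightarrow>
     (\<Sum>j\<in>E. cmod (partial_hilbert A a j) powr r * W j) \<le> D * (\<Sum>i\<in>A. cmod (a i) powr r * W i)"
    using partial_hilbert_A1[OF r, of K] by metis
  define C where "C = (8 * D + 1) powr (1/r)"
  have C: "C > 0" "C powr r = 8 * D + 1" using D(1) r by (auto simp: C_def powr_powr powr_one)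
  have sp: "(p i - r) * s i = p i" "1 < s i" "1 / (p i / r) + 1 / s i = 1" "1 < p i / r" for i
    using p[of i] r by (auto simp: s field_simps)
  have "(\<Sum>j\<in>E. (cmod (partial_hilbert A a j) / C) powr p j) \<le> 1"
    if A: "finite A" and E: "finite E" and a: "(\<Sum>i\<in>A. cmod (a i) powr p i) \<le> 1" for A E a
  proof (rule ccontr)
    define f where "f j = cmod (partial_hilbert A a j) / C" for j
    have f0: "0 \<le> f j" for j using C by (simp add: f_def)
    define S where "S = (\<Sum>j\<in>E. f j powr p j)"
    assume "\<not> ?thesis"
    then have S: "S > 1" by (simp add: S_def f_def)
    define h where "h j = (if j \<in> E then f j powr (p j - r) / S else 0)" for j
    have h0: "0 \<le> h j" for j using S by (simp add: h_def)
    have "\<exists>j\<in>E. f j \<noteq> 0"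
    proof (rule ccontr)
      assume "\<not> ?thesis"
      then have "S = 0" using p r by (auto simp: S_def)
      then show False using S by simp
    qed
    then have hpos: "\<exists>j. 0 < h j" using S f0 by (force simp: h_def)
    have "unit_modular s h"
      unfolding unit_modular_def
    proof (intro allI impI)
      fix F :: "int set" assume F: "finite F"
      have "(\<Sum>j\<in>F. h j powr s j) \<le> (\<Sum>j\<in>F \<union> E. h j powr s j)"
        using F E by (intro sum_mono2) auto
      also have "\<dots> = (\<Sum>j\<in>E. h j powr s j)"
        using F E by (intro sum.mono_neutral_right) (auto simp: h_def)
      also have "\<dots> \<le> (\<Sum>j\<in>E. f j powr p j / S)"
      proof (rule sum_mono)
        fix j assume j: "j \<in> E"
        have "h j powr s j = f j powr p j / S powr s j"
          using j S f0 by (simp add: h_def powr_divide powr_powr sp(1))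
        also have "\<dots> \<le> f j powr p j / S powr 1"
          using S sp(2)[of j] by (intro divide_left_mono powr_mono) auto
        finally show "h j powr s j \<le> f j powr p j / S" using S by simp
      qed
      also have "\<dots> = 1" using S by (simp add: S_def flip: sum_divide_distrib)
      finally show "(\<Sum>j\<in>F. h j powr s j) \<le> 1" .
    qed
    then obtain W where W: "A1_weight K W" "\<And>i. h i \<le> W i" "unit_modular s (\<lambda>i. W i / 4)"
      using K[of h] h0 hpos by auto
    have Wpos: "0 < W i" for i by (rule A1_weightD(1)[OF W(1)])
    have "1 = (\<Sum>j\<in>E. f j powr p j / S)" using S by (simp add: S_def flip: sum_divide_distrib)
    also have "\<dots> = (\<Sum>j\<in>E. f j powr r * h j)"
      by (intro sum.cong refl) (simp add: h_def flip: powr_add)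
    also have "\<dots> \<le> (\<Sum>j\<in>E. f j powr r * W j)" by (intro sum_mono mult_left_mono W(2)) auto
    also have "\<dots> = (\<Sum>j\<in>E. cmod (partial_hilbert A a j) powr r * W j) / C powr r"
      using C by (simp add: f_def powr_divide sum_divide_distrib)
    also have "\<dots> \<le> D * (\<Sum>i\<in>A. cmod (a i) powr r * W i) / C powr r"
      by (intro divide_right_mono D(2) W A E) auto
    also have "\<dots> \<le> D * 8 / C powr r"
    proof (intro divide_right_mono mult_left_mono D(1))
      have "(\<Sum>i\<in>A. cmod (a i) powr r * W i) = 4 * (\<Sum>i\<in>A. cmod (a i) powr r * (W i / 4))"
        by (simp add: sum_distrib_left)
      also have "\<dots> \<le> 4 * (\<Sum>i\<in>A. cmod (a i) powr p i + (W i / 4) powr s i)"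
      proof (intro mult_left_mono sum_mono)
        fix i
        have "cmod (a i) powr r * (W i / 4)
            \<le> (cmod (a i) powr r) powr (p i / r) / (p i / r) + (W i / 4) powr s i / s i"
          using sp[of i] Wpos[of i] by (intro Youngs_inequality) auto
        also have "\<dots> \<le> (cmod (a i) powr r) powr (p i / r) + (W i / 4) powr s i"
        proof (intro add_mono)
          have div_le: "x / c \<le> x" if "1 < c" "0 \<le> x" for x c :: real
            using that by (simp add: divide_le_eq mult_le_cancel_left1)
          show "(cmod (a i) powr r) powr (p i / r) / (p i / r) \<le> (cmod (a i) powr r) powr (p i / r)"
            "(W i / 4) powr s i / s i \<le> (W i / 4) powr s i"
            using sp(2,4)[of i] by (auto intro!: div_le simp del: divide_divide_eq_right)
        qed
        also have "(cmod (a i) powr r) powr (p i / r) = cmod (a i) powr p i"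
          using r by (simp add: powr_powr)
        finally show "cmod (a i) powr r * (W i / 4) \<le> cmod (a i) powr p i + (W i / 4) powr s i" .
      qed simp
      also have "\<dots> \<le> 4 * (1 + 1)"
        unfolding sum.distrib using a unit_modularD[OF W(3) A] by (intro mult_left_mono add_mono) auto
      finally show "(\<Sum>i\<in>A. cmod (a i) powr r * W i) \<le> 8" by simp
    qed auto
    also have "\<dots> < 1" using D(1) unfolding C(2) by simp
    finally show False by simp
  qed
  then show ?thesis using C(1) by blast
qed

section \<open>Boundedness on the variable exponent space\<close>

lemma tendsto_partial_hilbert:
  assumes "p \<in> class_P" "a \<in> lp_space p"
  shows "(\<lambda>N. partial_hilbert {- int N..int N} a j) \<longlonglongrightarrow> hilbert a j"
proof -
  let ?g = "\<lambda>i. a i / of_int (i - j)"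
  have "?g summable_on UNIV - {j}"
    using summable_hilbert[OF assms, of j] by (rule abs_summable_summable)
  then have "(?g has_sum hilbert a j) (UNIV - {j})"
    unfolding hilbert_def by (rule has_sum_infsum)
  then have lim: "(sum ?g \<longlongrightarrow> hilbert a j) (finite_subsets_at_top (UNIV - {j}))"
    by (simp only: has_sum_def)
  have "filterlim (\<lambda>N. {- int N..int N} - {j}) (finite_subsets_at_top (UNIV - {j})) sequentially"
    unfolding filterlim_finite_subsets_at_top
  proof (intro allI impI)
    fix X assume X: "finite X \<and> X \<subseteq> UNIV - {j}"
    then have "bdd_above (abs ` X)" by simp
    then obtain M where M: "\<And>i. i \<in> X \<Longrightarrow> \<bar>i\<bar> \<le> M" by (auto simp: bdd_above_def)
    show "\<forall>\<^sub>F N in sequentially. finite ({- int N..int N} - {j}) \<and> X \<subseteq> {- int N..int N} - {j}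
        \<and> {- int N..int N} - {j} \<subseteq> UNIV - {j}"
      using eventually_ge_at_top[of "nat M"]
    proof eventually_elim
      case (elim N)
      have "i \<in> {- int N..int N}" if "i \<in> X" for i
        using M[OF that] elim unfolding atLeastAtMost_iff by linarith
      then show ?case using X by blast
    qed
  qed
  then have "((\<lambda>N. sum ?g ({- int N..int N} - {j})) \<longlonglongrightarrow> hilbert a j)"
    by (rule filterlim_compose[OF lim])
  moreover have "sum ?g ({- int N..int N} - {j}) = partial_hilbert {- int N..int N} a j" for N
    unfolding partial_hilbert_def by (rule sum.mono_neutral_left) auto
  ultimately show ?thesis by simp
qed

text \<open>The lower bound for the exponent conjugate to \<open>p/r\<close> turns into an upper bound for \<open>p\<close>.\<close>

lemma class_P_of_conj_class_P:
  assumes p: "\<And>i. 1 \<le> p i" and r: "1 < r" "ereal r < exp_inf p"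
    and s: "conj_exp (\<lambda>i. p i / r) \<in> class_P"
  shows "p \<in> class_P" and "r < p i"
proof -
  have inf_le: "exp_inf q \<le> ereal (q i)" for q i
    unfolding exp_inf_def by (rule INF_lower) simp
  have rp: "r < p i" for i
    using less_le_trans[OF r(2) inf_le[of p i]] by simp
  then show "r < p i" .
  obtain c where c: "1 < ereal c" "ereal c < exp_inf (conj_exp (\<lambda>i. p i / r))"
    using s ereal_dense2[of 1 "exp_inf (conj_exp (\<lambda>i. p i / r))"] by (auto simp: class_P_def)
  have "p i \<le> r * c / (c - 1)" for i
  proof -
    have "c < conj_exp (\<lambda>i. p i / r) i"
      using less_le_trans[OF c(2) inf_le[of _ i]] by simp
    also have "\<dots> = p i / (p i - r)" using rp[of i] r(1) by (simp add: conj_exp_def field_simps)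
    finally have "c * (p i - r) < p i" using rp[of i] by (simp add: less_divide_eq)
    then show ?thesis using c(1) by (simp add: le_divide_eq algebra_simps)
  qed
  then have "exp_sup p \<le> ereal (r * c / (c - 1))"
    unfolding exp_sup_def by (intro SUP_least) simp
  then have "exp_sup p < \<infinity>" by (rule le_less_trans) simp
  moreover have "exp_inf p \<le> exp_sup p"
    unfolding exp_inf_def exp_sup_def by (rule INF_le_SUP) simp
  moreover have "1 < exp_inf p" using r by (metis ereal_less(3) less_trans one_ereal_def less_ereal.simps(1))
  ultimately show "p \<in> class_P" using p by (simp add: class_P_def)
qed

theorem theorem1p2:
  fixes p :: "int \<Rightarrow> real" and r :: real
  assumes "\<And>i. 1 \<le> p i"
    and "1 < r" and "ereal r < exp_inf p"
    and "conj_exp (\<lambda>i. p i / r) \<in> class_B"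
  shows "\<exists>C::real. C > 0 \<and>
    (\<forall>a\<in>lp_space p. lp_norm p (hilbert a) \<le> ennreal C * lp_norm p a)"
proof -
  have sP: "conj_exp (\<lambda>i. p i / r) \<in> class_P" using assms(4) by (simp add: class_B_def)
  have P: "p \<in> class_P" and rp: "r < p i" for i
    using class_P_of_conj_class_P[OF assms(1-3) sP] by auto
  have s: "conj_exp (\<lambda>i. p i / r) i = p i / (p i - r)" for i
    using rp[of i] assms(2) by (simp add: conj_exp_def field_simps)
  obtain C where C: "C > 0" "\<And>A a E. finite A \<Longrightarrow> finite E \<Longrightarrow> (\<Sum>i\<in>A. cmod (a i) powr p i) \<le> 1 \<Longrightarrow>
    (\<Sum>j\<in>E. (cmod (partial_hilbert A a j) / C) powr p j) \<le> 1"
    using extrapolation[OF assms(2) rp s assms(4)] by metis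
  have "lp_norm p (hilbert a) \<le> ennreal C * lp_norm p a" if a: "a \<in> lp_space p" for a
  proof -
    have bound: "lp_norm p (hilbert a) \<le> ennreal (C * l)"
      if l: "l > 0" "unit_modular p (\<lambda>i. cmod (a i) / l)" for l
    proof (rule lp_norm_le)
      show "unit_modular p (\<lambda>i. cmod (hilbert a i) / (C * l))"
        unfolding unit_modular_def
      proof (intro allI impI)
        fix F :: "int set" assume F: "finite F"
        have "(\<Sum>j\<in>F. (cmod (partial_hilbert {- int N..int N} a j) / (C * l)) powr p j) \<le> 1" for N
        proof -
          have "partial_hilbert {- int N..int N} (\<lambda>i. a i / of_real l) j
              = partial_hilbert {- int N..int N} a j / of_real l" for j
            by (simp add: partial_hilbert_def sum_divide_distrib mult.commute)
          then show ?thesis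
            using C(2)[of "{- int N..int N}" F "\<lambda>i. a i / of_real l"] F l
              unit_modularD[OF l(2), of "{- int N..int N}"]
            by (simp add: norm_divide mult.commute)
        qed
        moreover have "(\<lambda>N. \<Sum>j\<in>F. (cmod (partial_hilbert {- int N..int N} a j) / (C * l)) powr p j)
            \<longlonglongrightarrow> (\<Sum>j\<in>F. (cmod (hilbert a j) / (C * l)) powr p j)"
        proof (intro tendsto_sum tendsto_powr' tendsto_const)
          show "(\<lambda>N. cmod (partial_hilbert {- int N..int N} a j) / (C * l)) \<longlonglongrightarrow> cmod (hilbert a j) / (C * l)" for j
            using C(1) l(1)
            by (intro tendsto_divide tendsto_norm tendsto_const tendsto_partial_hilbert[OF P a]) auto
          show "cmod (hilbert a j) / (C * l) \<noteq> 0 \<or> 0 < p j \<and>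
              (\<forall>\<^sub>F N in sequentially. 0 \<le> cmod (partial_hilbert {- int N..int N} a j) / (C * l))" for j
            using C(1) l(1) rp[of j] assms(2) by (intro disjI2 conjI always_eventually) auto
        qed
        ultimately show "(\<Sum>j\<in>F. (cmod (hilbert a j) / (C * l)) powr p j) \<le> 1"
          by (intro LIMSEQ_le_const2) auto
      qed
    qed (use C l in simp)
    have "ennreal (1 / C) * lp_norm p (hilbert a) \<le> lp_norm p a"
      unfolding lp_norm_def[of p a]
    proof (rule INF_greatest, clarify)
      fix l :: real
      assume l: "0 < l" "(\<Sum>\<^sub>\<infinity>i. ennreal (cmod (a i / complex_of_real l) powr p i)) \<le> 1"
      have "ennreal (1 / C) * lp_norm p (hilbert a) \<le> ennreal (1 / C) * ennreal (C * l)"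
        using l by (intro mult_left_mono bound) (auto simp: infsum_modular_le_1_iff)
      also have "\<dots> = ennreal l" using C(1) l(1) by (simp add: ennreal_mult[symmetric])
      finally show "ennreal (1 / C) * lp_norm p (hilbert a) \<le> ennreal l" .
    qed
    then have "ennreal C * (ennreal (1 / C) * lp_norm p (hilbert a)) \<le> ennreal C * lp_norm p a"
      by (rule mult_left_mono) simp
    moreover have "ennreal C * (ennreal (1 / C) * lp_norm p (hilbert a)) = lp_norm p (hilbert a)"
      using C(1) by (simp add: mult.assoc[symmetric] ennreal_mult[symmetric])
    ultimately show ?thesis by simp
  qed
  then show ?thesis using C(1) by blast
qed

end
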